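(* Fix $t_0>0$ and for $\alpha\ge0$ let $A_\alpha:=\overline{\{(t,t^\alpha\sin(1/t)):0<t<t_0\}}\subset\mathbb{R}^2$. The (unrestricted) Point-Cross dimension at the origin satisfies \[ \dim_{\times}\{0\}_{A_\alpha}=\begin{cases}2,&0\le\alpha\le1,\\ 1,&\alpha>1.\end{cases} \] Consequently, for $0\le\alpha\le1$, the unrestricted Point-Cross dimension is strictly larger than the canonical profile: $\dim_{\times}^{\mathrm{can}}\{0\}_{A_\alpha}<\dim_{\times}\{0\}_{A_\alpha}$.
   Context: Tangent cone: for $A\subset\mathbb{R}^n$, $\mathrm{Tan}_x(A)$ is the set of $v\in\mathbb{R}^n$ for which there exist $x_k\in A$, $x_k\to x$, and positive reals $\lambda_k\downarrow0$ with $(x_k-x)/\lambda_k\to v$. Effective directions: $\mathrm{Eff}_x(A):=\mathrm{Tan}_x(A)\cap S^{n-1}$ if $x\in\overline A$ (and $\varnothing$ otherwise). For $v\ne0$ let $[v]=\mathbb{R}v\in\mathbb{P}^{n-1}$; $\mathrm{Eff}_x^{\mathbb P}(A):=\{[v]:v\in\mathrm{Eff}_x(A)\}$. Admissible probes: for $x\in\overline A$, $v\in S^{n-1}$, $\mathcal G_x^A(v)$ is the family of all injective Lipschitz maps $\gamma:[0,\delta]\to\mathbb{R}^n$ (some $\delta>0$) with $\gamma(0)=x$, $\lim_{t\to0^+}\frac{\gamma(t)-x}{\|\gamma(t)-x\|}=v$, and $A\cap\gamma((0,\eta])\ne\varnothing$ for every $\eta\in(0,\delta]$; $\Gamma_\gamma:=\gamma([0,\delta])$.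 Point-extended box dimension: for bounded $E$, $N_\varepsilon(E)$ is the minimal number of sets of diameter at most $\varepsilon$ covering $E$ and $\overline{\dim}_B(E):=\limsup_{\varepsilon\to0}\frac{\ln N_\varepsilon(E)}{\ln(1/\varepsilon)}$. For $x\in\overline E$, $\dim_{\mathrm{Pbox}}\{x\}_E:=\inf_{r>0}\overline{\dim}_B(E\cap B(x,r))$; it is $0$ if $x\notin\overline E$. Directional contribution: for $v\in\mathrm{Eff}_x(A)$, $\theta_x^A(v):=\sup_{\gamma\in\mathcal G_x^A(v)}\dim_{\mathrm{Pbox}}\{x\}_{A\cap\Gamma_\gamma}$; for $\xi\in\mathrm{Eff}_x^{\mathbb P}(A)$, $\theta_x^A(\xi):=\sup\{\theta_x^A(w):w\in\mathrm{Eff}_x(A),[w]=\xi\}$. Point-Cross dimension at $x\in\overline A$: $\dim_\times\{x\}_A:=\sup\sum_{i=1}^m\theta_x^A(\xi_i)$ over all $m\in\{0,\dots,n\}$ and all $\xi_1,\dots,\xi_m\in\mathrm{Eff}_x^{\mathbb P}(A)$ that are projectively (linearly) independent, i.e. nonzero representatives are linearly independent (empty family allowed, with sum $0$). Canonical profile: $\dim_\times^{\mathrm{can}}\{0\}_{A_\alpha}$ is the largest sum of contributions $\dim_{\mathrm{Pbox}}\{0\}_{A_\alpha\cap\Gamma_\gamma}$ over finite families of canonical probes $\gamma$ at the origin whose limiting projective directions are projectively independent. For $0\le\alpha\le1$ the canonical probes are: the straight probes $t\mapsto t(1,m)$, $t\in[0,\delta]$, for the effective finite slopes $m$ (all $m\in\mathbb{R}$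 if $0\le\alpha<1$, and $m\in[-1,1]$ if $\alpha=1$); for $0<\alpha<1$, also the arclength-parametrized envelope arc $\{(t,t^\alpha):0\le t\le t_0\}$ (vertical peak probe); for $\alpha=0$, also the straight vertical probe along the segment $\{0\}\times[-1,1]\subset A_0$. (For $\alpha>1$ the canonical probe is the graph itself, parametrized by arclength from the origin.) *)

theory Defs
  imports "HOL-Analysis.Analysis"
begin

definition tangent_cone :: "'a::euclidean_space set \<Rightarrow> 'a \<Rightarrow> 'a set" where
  "tangent_cone A x = {v. \<exists>(X :: nat \<Rightarrow> 'a) (l :: nat \<Rightarrow> real).
     (\<forall>k. X k \<in> A) \<and> X \<longlonglongrightarrow> x \<and> (\<forall>k. l k > 0) \<and> decseq l \<and> l \<longlonglongrightarrow> 0 \<and>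
     (\<lambda>k. (X k - x) /\<^sub>R l k) \<longlonglongrightarrow> v}"

definition eff_dirs :: "'a::euclidean_space set \<Rightarrow> 'a \<Rightarrow> 'a set" where
  "eff_dirs A x = (if x \<in> closure A then tangent_cone A x \<inter> sphere 0 1 else {})"

text \<open>A point of projective space is represented as the line through a nonzero vector.\<close>

definition proj_class :: "'a::euclidean_space \<Rightarrow> 'a set" where
  "proj_class v = span {v}"

definition proj_eff_dirs :: "'a::euclidean_space set \<Rightarrow> 'a \<Rightarrow> 'a set set" where
  "proj_eff_dirs A x = proj_class ` eff_dirs A x"

text \<open>Independence of the family of projective points \<open>\<xi> 0, \<dots>, \<xi> (m - 1)\<close>; it does not depend
  on the chosen representatives \<open>u i\<close>.\<close>

definition proj_independent :: "nat \<Rightarrow> (nat \<Rightarrow> 'a::euclidean_space set) \<Rightarrow> bool" where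
  "proj_independent m \<xi> \<longleftrightarrow>
     (\<exists>u. (\<forall>i<m. u i \<noteq> 0 \<and> \<xi> i = proj_class (u i)) \<and>
          inj_on u {..<m} \<and> independent (u ` {..<m}))"

definition limit_direction :: "(real \<Rightarrow> 'a::euclidean_space) \<Rightarrow> 'a \<Rightarrow> 'a \<Rightarrow> bool" where
  "limit_direction \<gamma> x v \<longleftrightarrow> ((\<lambda>t. (\<gamma> t - x) /\<^sub>R norm (\<gamma> t - x)) \<longlongrightarrow> v) (at_right 0)"

text \<open>A probe \<open>\<gamma> : [0,\<delta>] \<rightarrow> \<real>\<^sup>n\<close> is the pair \<open>(\<delta>, \<gamma>)\<close>; the values of \<open>\<gamma>\<close> outside
  \<open>[0,\<delta>]\<close> are irrelevant.\<close>

definition probes :: "'a::euclidean_space set \<Rightarrow> 'a \<Rightarrow> 'a \<Rightarrow> (real \<times> (real \<Rightarrow> 'a)) set" where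
  "probes A x v = {(\<delta>, \<gamma>). \<delta> > 0 \<and> inj_on \<gamma> {0..\<delta>} \<and> (\<exists>L. L-lipschitz_on {0..\<delta>} \<gamma>) \<and>
     \<gamma> 0 = x \<and> limit_direction \<gamma> x v \<and> (\<forall>\<eta>\<in>{0<..\<delta>}. A \<inter> \<gamma> ` {0<..\<eta>} \<noteq> {})}"

text \<open>Boundedness of the covering sets is required explicitly because \<^const>\<open>diameter\<close> is
  meaningless on unbounded sets.\<close>

definition covering_number :: "real \<Rightarrow> 'a::euclidean_space set \<Rightarrow> nat" where
  "covering_number \<epsilon> E = (LEAST k. \<exists>\<C>. finite \<C> \<and> card \<C> = k \<and> E \<subseteq> \<Union>\<C> \<and>
     (\<forall>S\<in>\<C>. bounded S \<and> diameter S \<le> \<epsilon>))"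

text \<open>All dimensions take values in \<^typ>\<open>ennreal\<close>, so that a supremum over the empty family is
  \<open>0\<close>. For nonempty bounded \<open>E\<close> and \<open>\<epsilon> < 1\<close> the quotient below is nonnegative, hence not
  affected by the truncation in \<^const>\<open>ennreal\<close>; empty \<open>E\<close> do not occur in \<open>pbox_dim\<close>.\<close>

definition upper_box_dim :: "'a::euclidean_space set \<Rightarrow> ennreal" where
  "upper_box_dim E =
     Limsup (at_right 0) (\<lambda>\<epsilon>. ennreal (ln (real (covering_number \<epsilon> E)) / ln (1 / \<epsilon>)))"

definition pbox_dim :: "'a::euclidean_space set \<Rightarrow> 'a \<Rightarrow> ennreal" where
  "pbox_dim E x = (if x \<in> closure E then INF r\<in>{0<..}. upper_box_dim (E \<inter> ball x r) else 0)"

definition probe_contribution ::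
  "'a::euclidean_space set \<Rightarrow> 'a \<Rightarrow> real \<times> (real \<Rightarrow> 'a) \<Rightarrow> ennreal" where
  "probe_contribution A x = (\<lambda>(\<delta>, \<gamma>). pbox_dim (A \<inter> \<gamma> ` {0..\<delta>}) x)"

definition dir_contribution :: "'a::euclidean_space set \<Rightarrow> 'a \<Rightarrow> 'a \<Rightarrow> ennreal" where
  "dir_contribution A x v = (SUP p\<in>probes A x v. probe_contribution A x p)"

definition proj_contribution :: "'a::euclidean_space set \<Rightarrow> 'a \<Rightarrow> 'a set \<Rightarrow> ennreal" where
  "proj_contribution A x \<xi> =
     (SUP w\<in>{w \<in> eff_dirs A x. proj_class w = \<xi>}. dir_contribution A x w)"

definition point_cross_dim :: "'a::euclidean_space set \<Rightarrow> 'a \<Rightarrow> ennreal" where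
  "point_cross_dim A x =
     (SUP (m, \<xi>) \<in> {(m, \<xi>). m \<le> DIM('a) \<and> (\<forall>i<m. \<xi> i \<in> proj_eff_dirs A x) \<and>
        proj_independent m \<xi>}. \<Sum>i<m. proj_contribution A x (\<xi> i))"

definition osc_set :: "real \<Rightarrow> real \<Rightarrow> (real \<times> real) set" where
  "osc_set t\<^sub>0 \<alpha> = closure ((\<lambda>t. (t, t powr \<alpha> * sin (1 / t))) ` {0<..<t\<^sub>0})"

definition curve_length :: "(real \<Rightarrow> 'a::euclidean_space) \<Rightarrow> real \<Rightarrow> real \<Rightarrow> ennreal" where
  "curve_length \<gamma> a b =
     (SUP (k, p) \<in> {(k :: nat, p :: nat \<Rightarrow> real). mono_on {..k} p \<and> p ` {..k} \<subseteq> {a..b}}.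
        \<Sum>i<k. ennreal (dist (\<gamma> (p i)) (\<gamma> (p (Suc i)))))"

definition arclength_probes :: "'a::euclidean_space \<Rightarrow> 'a set \<Rightarrow> (real \<times> (real \<Rightarrow> 'a)) set" where
  "arclength_probes x \<Gamma> = {(\<delta>, \<gamma>). \<delta> > 0 \<and> \<gamma> 0 = x \<and> inj_on \<gamma> {0..\<delta>} \<and> \<gamma> ` {0..\<delta>} = \<Gamma> \<and>
     (\<forall>s\<in>{0..\<delta>}. curve_length \<gamma> 0 s = ennreal s)}"

definition straight_probes :: "real set \<Rightarrow> (real \<times> (real \<Rightarrow> real \<times> real)) set" where
  "straight_probes M = {(\<delta>, \<lambda>t. t *\<^sub>R (1, m)) | \<delta> m. \<delta> > 0 \<and> m \<in> M}"

text \<open>For \<open>\<alpha> = 0\<close> a probe starting at the origin runs along one half of the segment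
  \<open>{0} \<times> [-1,1]\<close>; both halves are admitted. For \<open>\<alpha> > 1\<close> the set \<^term>\<open>osc_set t\<^sub>0 \<alpha>\<close> is the
  graph together with its two endpoints.\<close>

definition canonical_probes :: "real \<Rightarrow> real \<Rightarrow> (real \<times> (real \<Rightarrow> real \<times> real)) set" where
  "canonical_probes t\<^sub>0 \<alpha> =
     (if \<alpha> = 0 then straight_probes UNIV \<union> {(1, \<lambda>t. (0, t)), (1, \<lambda>t. (0, - t))}
      else if 0 < \<alpha> \<and> \<alpha> < 1 then
        straight_probes UNIV \<union> arclength_probes 0 ((\<lambda>t. (t, t powr \<alpha>)) ` {0..t\<^sub>0})
      else if \<alpha> = 1 then straight_probes {-1..1}
      else if \<alpha> > 1 then arclength_probes 0 (osc_set t\<^sub>0 \<alpha>)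
      else {})"

definition canonical_profile :: "real \<Rightarrow> real \<Rightarrow> ennreal" where
  "canonical_profile t\<^sub>0 \<alpha> =
     (SUP (m, P) \<in> {(m :: nat, P). (\<forall>i<m. P i \<in> canonical_probes t\<^sub>0 \<alpha>) \<and>
        (\<exists>v. (\<forall>i<m. limit_direction (snd (P i)) 0 (v i)) \<and>
             proj_independent m (\<lambda>i. proj_class (v i)))}.
        \<Sum>i<m. probe_contribution (osc_set t\<^sub>0 \<alpha>) 0 (P i))"

end

(* Every probe is a Lipschitz curve, so a direction contributes at most 1, and only the number of
   independent directions limits the dimension from above. A probe attains 1 as soon as it contains
   arcs of the graph of f(x) = x^\<alpha> sin(1/x) arbitrarily close to the origin. Given a slope
   0 \<le> m < 1, follow the graph along very short ascending arcs at which it crosses the line y = m x,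
   one arc per oscillation. In the coordinate u = x + y these arcs form a partial Lipschitz graph, however
   steep they are; a Lipschitz extension joins them into a probe, which remains tangent to the line
   because consecutive arcs are relatively close. The slopes 0 and 1/2 give the value 2 for \<alpha> \<le> 1;
   for \<alpha> > 1 the only effective direction is horizontal.
   A straight probe, in contrast, meets the graph at \<theta> = 1/t with sin \<theta> = m \<theta>^(\<alpha> - 1), and by
   applying the mean value theorem twice these \<theta> have bounded density, which gives dimension at most
   1/2 at the origin. All other canonical probes are vertical, so an independent family
   contains at most one of them. *)
theory Submission
  imports Defs "HOL-Real_Asymp.Real_Asymp"
begin

section \<open>Covering numbers and box dimension\<close>

lemma covering_number_le_card:
  assumes "finite C" "E \<subseteq> \<Union>C" "\<And>S. S \<in> C \<Longrightarrow> bounded S \<and> diameter S \<le> \<epsilon>"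
  shows "covering_number \<epsilon> E \<le> card C"
  unfolding covering_number_def using assms by (intro Least_le) blast

text \<open>Bounded sets are totally bounded, so finite covers exist and the \<open>LEAST\<close> in
  \<open>covering_number\<close> is attained; without a witness its value would be
  unspecified.\<close>

lemma covering_number_cover:
  fixes E :: "'a::euclidean_space set"
  assumes "bounded E" "\<epsilon> > 0"
  obtains C where "finite C" "card C = covering_number \<epsilon> E" "E \<subseteq> \<Union>C"
    "\<And>S. S \<in> C \<Longrightarrow> bounded S \<and> diameter S \<le> \<epsilon>"
proof -
  have "compact (closure E)" using assms by simp
  then obtain K where K: "finite K" "closure E \<subseteq> (\<Union>x\<in>K. ball x (\<epsilon>/2))"
    using assms(2) unfolding compact_eq_totally_bounded by (meson half_gt_zero)
  let ?C = "(\<lambda>x. ball x (\<epsilon>/2)) ` K"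
  have "\<exists>C. finite C \<and> card C = card ?C \<and> E \<subseteq> \<Union>C \<and> (\<forall>S\<in>C. bounded S \<and> diameter S \<le> \<epsilon>)"
    using K closure_subset[of E] assms(2) by (intro exI[of _ ?C]) auto
  from LeastI_ex[OF exI, of "\<lambda>k. \<exists>C. finite C \<and> card C = k \<and> E \<subseteq> \<Union>C \<and> (\<forall>S\<in>C. bounded S \<and> diameter S \<le> \<epsilon>)", OF this]
  show ?thesis using that unfolding covering_number_def by blast
qed

lemma covering_number_mono:
  fixes E :: "'a::euclidean_space set"
  assumes "E \<subseteq> F" "bounded F" "\<epsilon> > 0"
  shows "covering_number \<epsilon> E \<le> covering_number \<epsilon> F"
proof -
  obtain C where "finite C" "card C = covering_number \<epsilon> F" "F \<subseteq> \<Union>C"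
    "\<And>S. S \<in> C \<Longrightarrow> bounded S \<and> diameter S \<le> \<epsilon>"
    using covering_number_cover[OF assms(2,3)] by blast
  then show ?thesis using covering_number_le_card[of C E \<epsilon>] assms(1) by fastforce
qed

lemma covering_number_Un_le:
  fixes E :: "'a::euclidean_space set"
  assumes "bounded E" "bounded F" "\<epsilon> > 0"
  shows "covering_number \<epsilon> (E \<union> F) \<le> covering_number \<epsilon> E + covering_number \<epsilon> F"
proof -
  obtain C where C: "finite C" "card C = covering_number \<epsilon> E" "E \<subseteq> \<Union>C"
    "\<And>S. S \<in> C \<Longrightarrow> bounded S \<and> diameter S \<le> \<epsilon>"
    using covering_number_cover[OF assms(1,3)] by blast
  obtain D where D: "finite D" "card D = covering_number \<epsilon> F" "F \<subseteq> \<Union>D"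
    "\<And>S. S \<in> D \<Longrightarrow> bounded S \<and> diameter S \<le> \<epsilon>"
    using covering_number_cover[OF assms(2,3)] by blast
  have "covering_number \<epsilon> (E \<union> F) \<le> card (C \<union> D)"
    using C D by (intro covering_number_le_card) auto
  also have "\<dots> \<le> card C + card D" by (rule card_Un_le)
  finally show ?thesis using C D by simp
qed

lemma covering_number_finite_le:
  fixes E :: "'a::euclidean_space set"
  assumes "finite E" "\<epsilon> \<ge> 0"
  shows "covering_number \<epsilon> E \<le> card E"
proof -
  have "covering_number \<epsilon> E \<le> card ((\<lambda>x. {x}) ` E)"
    using assms by (intro covering_number_le_card) auto
  also have "\<dots> \<le> card E" using assms by (intro card_image_le)
  finally show ?thesis .
qed

text \<open>Packing bound: a set of diameter at most \<open>\<epsilon>\<close> contains at most one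
  point of a family with mutual distances above \<open>\<epsilon>\<close>.\<close>

lemma card_le_covering_number:
  fixes E :: "'a::euclidean_space set"
  assumes "bounded E" "\<epsilon> > 0" "D \<subseteq> E" "\<And>x y. x \<in> D \<Longrightarrow> y \<in> D \<Longrightarrow> x \<noteq> y \<Longrightarrow> dist x y > \<epsilon>"
  shows "card D \<le> covering_number \<epsilon> E"
proof -
  obtain C where C: "finite C" "card C = covering_number \<epsilon> E" "E \<subseteq> \<Union>C"
    "\<And>S. S \<in> C \<Longrightarrow> bounded S \<and> diameter S \<le> \<epsilon>"
    using covering_number_cover[OF assms(1,2)] by blast
  have "\<forall>x\<in>D. \<exists>S\<in>C. x \<in> S" using C(3) assms(3) by blast
  then obtain h where h: "\<And>x. x \<in> D \<Longrightarrow> h x \<in> C \<and> x \<in> h x" by metis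
  have "inj_on h D"
  proof (rule inj_onI, rule ccontr)
    fix x y assume xy: "x \<in> D" "y \<in> D" "h x = h y" "x \<noteq> y"
    have "dist x y \<le> diameter (h x)"
      using h[OF xy(1)] h[OF xy(2)] xy(3) C(4)[of "h x"] by (intro diameter_bounded_bound) auto
    then show False using C(4)[of "h x"] h xy assms(4)[of x y] by fastforce
  qed
  then show ?thesis using card_inj_on_le[of h D C] h C by auto
qed

lemma covering_number_lipschitz_curve_le:
  fixes \<gamma> :: "real \<Rightarrow> 'a::euclidean_space"
  assumes lip: "L-lipschitz_on {0..d} \<gamma>" and "d \<ge> 0" "\<epsilon> > 0"
  shows "real (covering_number \<epsilon> (\<gamma> ` {0..d})) \<le> L * d / \<epsilon> + 2"
proof -
  have L: "L \<ge> 0" using lip lipschitz_on_nonneg by blast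
  \<comment> \<open>Cut the parameter interval into \<open>n\<close> equal pieces, each with image
    of diameter at most \<open>L * d / n \<le> \<epsilon>\<close>. The summand 1 keeps
    \<open>n\<close> positive when \<open>L * d = 0\<close>.\<close>
  define n where "n = nat \<lceil>L * d / \<epsilon>\<rceil> + 1"
  have n: "real n \<ge> L * d / \<epsilon>" "real n \<le> L * d / \<epsilon> + 2" "n > 0"
    using L assms(2,3) unfolding n_def by (auto, linarith+)
  define J where "J = (\<lambda>j::nat. \<gamma> ` ({0..d} \<inter> {j * d / n .. (real j + 1) * d / n}))"
  have cov: "\<gamma> ` {0..d} \<subseteq> \<Union>(J ` {..<n})"
  proof
    fix p assume "p \<in> \<gamma> ` {0..d}"
    then obtain t where t: "t \<in> {0..d}" "p = \<gamma> t" by blast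
    show "p \<in> \<Union>(J ` {..<n})"
    \<comment> \<open>The floor formula below would give \<open>t = d\<close> the index
      \<open>n\<close>, so the right endpoint is assigned to the last piece separately.\<close>
    proof (cases "t = d")
      case True
      then have "p \<in> J (n - 1)" using t n(3) assms(2) unfolding J_def
        by (auto simp: of_nat_diff field_simps intro!: imageI)
      then show ?thesis using n(3) by auto
    next
      case False
      then have d: "d > 0" "t < d" using t by auto
      define j where "j = nat \<lfloor>t * n / d\<rfloor>"
      have "0 \<le> t * n / d" using t d by simp
      then have "real j \<le> t * n / d" "t * n / d < real j + 1"
        unfolding j_def by linarith+
      moreover have "t * n / d < n" using d n by (simp add: field_simps)
      ultimately have "j < n" by linarith
      moreover have "j * d / n \<le> t" "t \<le> (real j + 1) * d / n"
        using d n \<open>real j \<le> t * n / d\<close> \<open>t * n / d < real j + 1\<close> by (auto simp: field_simps)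
      ultimately have "p \<in> J j" using t unfolding J_def by (auto simp: add.commute intro!: imageI)
      then show ?thesis using \<open>j < n\<close> by blast
    qed
  qed
  have "covering_number \<epsilon> (\<gamma> ` {0..d}) \<le> card (J ` {..<n})"
  proof (rule covering_number_le_card[OF _ cov])
    fix S assume "S \<in> J ` {..<n}"
    then obtain j where j: "S = J j" by blast
    have "diameter S \<le> \<epsilon>"
    proof (rule diameter_le)
      show "S \<noteq> {} \<or> 0 \<le> \<epsilon>" using assms by simp
      fix x y assume "x \<in> S" "y \<in> S"
      then obtain s t where st: "x = \<gamma> s" "y = \<gamma> t" "s \<in> {0..d}" "t \<in> {0..d}"
        "s \<in> {j * d / n .. (real j + 1) * d / n}" "t \<in> {j * d / n .. (real j + 1) * d / n}"
        unfolding j J_def by blast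
      have "(real j + 1) * d / n = j * d / n + d / n" by (simp add: algebra_simps add_divide_distrib)
      then have "dist s t \<le> d / n" using st(5,6) unfolding dist_real_def by auto
      have "norm (x - y) \<le> L * dist s t" using lipschitz_onD[OF lip st(3,4)] st by (simp add: dist_norm)
      also have "\<dots> \<le> L * (d / n)" using L \<open>dist s t \<le> d / n\<close> by (intro mult_left_mono)
      also have "\<dots> \<le> \<epsilon>" using n assms by (simp add: field_simps)
      finally show "norm (x - y) \<le> \<epsilon>" .
    qed
    moreover have "bounded S"
    proof -
      have "bounded (\<gamma> ` {0..d})"
        using lip by (intro compact_imp_bounded compact_continuous_image lipschitz_on_continuous_on) auto
      then show ?thesis using j unfolding J_def by (elim bounded_subset) auto
    qed
    ultimately show "bounded S \<and> diameter S \<le> \<epsilon>" by blast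
  qed auto
  also have "\<dots> \<le> n" using card_image_le[of "{..<n}" J] by simp
  finally show ?thesis using n(2) by linarith
qed

lemma eventually_at_right_0_less_1: "eventually (\<lambda>\<epsilon>::real. 0 < \<epsilon> \<and> \<epsilon> < 1) (at_right 0)"
  by (rule eventually_at_rightI[of 0 1]) auto

section \<open>Box dimension from estimates of covering numbers\<close>

lemma upper_box_dim_le:
  assumes "s \<ge> 0" "C \<ge> 1"
    and "eventually (\<lambda>\<epsilon>. real (covering_number \<epsilon> E) \<le> C * \<epsilon> powr (-s)) (at_right 0)"
  shows "upper_box_dim E \<le> ennreal s"
proof -
  \<comment> \<open>The constant \<open>C\<close> contributes only \<open>ln C\<close>, which is
    negligible against \<open>ln (1 / \<epsilon>)\<close>, so the comparison function tends to
    \<open>s\<close>.\<close>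
  let ?g = "\<lambda>\<epsilon>. ennreal ((ln C + s * ln (1 / \<epsilon>)) / ln (1 / \<epsilon>))"
  from eventually_at_right_0_less_1 have "eventually (\<lambda>\<epsilon>. ennreal (ln (real (covering_number \<epsilon> E)) / ln (1 / \<epsilon>)) \<le> ?g \<epsilon>) (at_right 0)"
    using assms(3)
  proof eventually_elim
    case (elim \<epsilon>)
    then have pos: "ln (1 / \<epsilon>) > 0" by simp
    have "ln (real (covering_number \<epsilon> E)) \<le> ln C + s * ln (1 / \<epsilon>)"
    \<comment> \<open>Here \<open>ln 0 = 0\<close>, and \<open>C \<ge> 1\<close> makes the
      right-hand side nonnegative.\<close>
    proof (cases "covering_number \<epsilon> E = 0")
      case True
      then show ?thesis using pos assms by simp
    next
      case False
      then have "ln (real (covering_number \<epsilon> E)) \<le> ln (C * \<epsilon> powr (-s))" using elim assms by simp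
      also have "\<dots> = ln C + s * ln (1 / \<epsilon>)" using elim assms
        by (simp add: ln_mult ln_div ln_powr)
      finally show ?thesis .
    qed
    then show ?case using pos by (intro ennreal_leI divide_right_mono) auto
  qed
  then have "upper_box_dim E \<le> Limsup (at_right 0) ?g"
    unfolding upper_box_dim_def by (rule Limsup_mono)
  also have "((\<lambda>\<epsilon>. (ln C + s * ln (1 / \<epsilon>)) / ln (1 / \<epsilon>)) \<longlongrightarrow> s) (at_right 0)" by real_asymp
  then have "Limsup (at_right 0) ?g = ennreal s"
    by (intro lim_imp_Limsup tendsto_ennrealI) auto
  finally show ?thesis .
qed

lemma upper_box_dim_ge:
  assumes "c > 0" "eventually (\<lambda>\<epsilon>. c * \<epsilon> powr (-s) \<le> real (covering_number \<epsilon> E)) (at_right 0)"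
  shows "ennreal s \<le> upper_box_dim E"
proof -
  let ?g = "\<lambda>\<epsilon>. ennreal ((ln c + s * ln (1 / \<epsilon>)) / ln (1 / \<epsilon>))"
  from eventually_at_right_0_less_1 have "eventually (\<lambda>\<epsilon>. ?g \<epsilon> \<le> ennreal (ln (real (covering_number \<epsilon> E)) / ln (1 / \<epsilon>))) (at_right 0)"
    using assms(2)
  proof eventually_elim
    case (elim \<epsilon>)
    then have pos: "ln (1 / \<epsilon>) > 0" by simp
    have "ln c + s * ln (1 / \<epsilon>) = ln (c * \<epsilon> powr (-s))" using elim assms
      by (simp add: ln_mult ln_div ln_powr)
    also have "\<dots> \<le> ln (real (covering_number \<epsilon> E))"
    proof -
      have "0 < c * \<epsilon> powr (-s)" using elim assms by simp
      then show ?thesis using elim by (subst ln_le_cancel_iff) linarith+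
    qed
    finally show ?case using pos by (intro ennreal_leI divide_right_mono) auto
  qed
  then have "Limsup (at_right 0) ?g \<le> upper_box_dim E"
    unfolding upper_box_dim_def by (rule Limsup_mono)
  moreover have "((\<lambda>\<epsilon>. (ln c + s * ln (1 / \<epsilon>)) / ln (1 / \<epsilon>)) \<longlongrightarrow> s) (at_right 0)" by real_asymp
  then have "Limsup (at_right 0) ?g = ennreal s"
    by (intro lim_imp_Limsup tendsto_ennrealI) auto
  ultimately show ?thesis by simp
qed

lemma upper_box_dim_lipschitz_curve_le_1:
  fixes \<gamma> :: "real \<Rightarrow> 'a::euclidean_space"
  assumes lip: "L-lipschitz_on {0..d} \<gamma>" and "d \<ge> 0" "E \<subseteq> \<gamma> ` {0..d}"
  shows "upper_box_dim E \<le> 1"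
proof -
  have L: "L \<ge> 0" using lip lipschitz_on_nonneg by blast
  have bdd: "bounded (\<gamma> ` {0..d})"
    using lip by (intro compact_imp_bounded compact_continuous_image lipschitz_on_continuous_on) auto
  from eventually_at_right_0_less_1 have "eventually (\<lambda>\<epsilon>. real (covering_number \<epsilon> E) \<le> (L * d + 2) * \<epsilon> powr (-1)) (at_right 0)"
  proof eventually_elim
    case (elim \<epsilon>)
    have "real (covering_number \<epsilon> E) \<le> real (covering_number \<epsilon> (\<gamma> ` {0..d}))"
      using covering_number_mono[OF assms(3) bdd, of \<epsilon>] elim by simp
    also have "\<dots> \<le> L * d / \<epsilon> + 2"
      using covering_number_lipschitz_curve_le[OF lip assms(2)] elim by simp
    also have "\<dots> \<le> (L * d + 2) * \<epsilon> powr (-1)"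
      using elim by (simp add: powr_minus field_simps)
    finally show ?case .
  qed
  then have "upper_box_dim E \<le> ennreal 1"
    using L assms by (intro upper_box_dim_le[where C = "L * d + 2"]) auto
  then show ?thesis by simp
qed

text \<open>The first projection does not increase distances, so points of \<open>E\<close> over a
  grid of step \<open>2 * \<epsilon>\<close> in \<open>{a..b}\<close> form an
  \<open>\<epsilon>\<close>-separated family whose size is of order
  \<open>1 / \<epsilon>\<close>.\<close>

lemma upper_box_dim_ge_1:
  fixes E :: "(real \<times> real) set"
  assumes "bounded E" "a < b" "{a..b} \<subseteq> fst ` E"
  shows "1 \<le> upper_box_dim E"
proof -
  from eventually_at_right_0_less_1 have "eventually (\<lambda>\<epsilon>. (b - a) / 2 * \<epsilon> powr (-1) \<le> real (covering_number \<epsilon> E)) (at_right 0)"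
  proof eventually_elim
    case (elim \<epsilon>)
    define n where "n = nat \<lfloor>(b - a) / (2 * \<epsilon>)\<rfloor>"
    have n: "real n \<le> (b - a) / (2 * \<epsilon>)" "(b - a) / (2 * \<epsilon>) \<le> real (n + 1)"
      using assms elim unfolding n_def by (auto, linarith+)
    have in_E: "\<exists>p\<in>E. fst p = a + 2 * \<epsilon> * real j" if "j \<le> n" for j
    proof -
      have "2 * \<epsilon> * real j \<le> 2 * \<epsilon> * real n" using elim that by simp
      also have "\<dots> \<le> b - a" using n elim by (simp add: field_simps)
      finally have "a + 2 * \<epsilon> * real j \<in> {a..b}" using elim by simp
      then have "a + 2 * \<epsilon> * real j \<in> fst ` E" using assms(3) by blast
      then show ?thesis by (metis imageE)
    qed
    then obtain p where p: "\<And>j. j \<le> n \<Longrightarrow> p j \<in> E" "\<And>j. j \<le> n \<Longrightarrow> fst (p j) = a + 2 * \<epsilon> * real j"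
      by metis
    have sep: "dist (p i) (p j) > \<epsilon>" if "i \<le> n" "j \<le> n" "i \<noteq> j" for i j
    proof -
      have "\<epsilon> < 2 * \<epsilon> * 1" using elim by simp
      also have "\<dots> \<le> 2 * \<epsilon> * \<bar>real i - real j\<bar>" using that elim by (intro mult_left_mono) auto
      also have "\<dots> = dist (fst (p i)) (fst (p j))"
        using p that elim by (simp add: dist_real_def abs_mult flip: right_diff_distrib)
      also have "\<dots> \<le> dist (p i) (p j)" by (rule dist_fst_le)
      finally show ?thesis .
    qed
    have "inj_on p {..n}" using sep elim by (intro inj_onI) (metis atMost_iff dist_self less_asym)
    then have "card (p ` {..n}) = n + 1" by (simp add: card_image)
    moreover have "card (p ` {..n}) \<le> covering_number \<epsilon> E"
    proof (rule card_le_covering_number)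
      fix x y assume "x \<in> p ` {..n}" "y \<in> p ` {..n}" "x \<noteq> y"
      then show "dist x y > \<epsilon>" using sep by blast
    qed (use assms elim p in auto)
    ultimately have "(b - a) / (2 * \<epsilon>) \<le> real (covering_number \<epsilon> E)" using n(2) by linarith
    then show ?case using elim by (simp add: powr_minus field_simps)
  qed
  then have "ennreal 1 \<le> upper_box_dim E"
    using assms by (intro upper_box_dim_ge[where c = "(b - a) / 2"]) auto
  then show ?thesis by simp
qed

lemma pbox_dim_le: "r > 0 \<Longrightarrow> upper_box_dim (E \<inter> ball x r) \<le> s \<Longrightarrow> pbox_dim E x \<le> s"
  unfolding pbox_dim_def by (auto intro: INF_lower2)

lemma dir_contribution_le_1: "dir_contribution A x v \<le> 1"
  unfolding dir_contribution_def
proof (rule SUP_least)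
  fix p assume "p \<in> probes A x v"
  then obtain \<delta> \<gamma> L where p: "p = (\<delta>, \<gamma>)" "\<delta> > 0" "L-lipschitz_on {0..\<delta>} \<gamma>"
    unfolding probes_def by auto
  show "probe_contribution A x p \<le> 1"
    unfolding p probe_contribution_def using p(2)
    by (auto intro!: pbox_dim_le[of 1] upper_box_dim_lipschitz_curve_le_1[OF p(3)])
qed

lemma proj_contribution_le_1: "proj_contribution A x \<xi> \<le> 1"
  unfolding proj_contribution_def by (auto intro!: SUP_least dir_contribution_le_1)

section \<open>Probes following the ascending arcs of the graph\<close>

text \<open>McShane's extension: the infimum over \<open>s\<close> in \<open>S\<close> of the cones
  \<open>f s + L * dist x s\<close>. Each cone is Lipschitz in \<open>x\<close> with constant
  \<open>L\<close>, and the Lipschitz bound on \<open>S\<close> keeps the prescribed values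
  there.\<close>

lemma lipschitz_extension_real:
  fixes f :: "'a::metric_space \<Rightarrow> real"
  assumes lip: "L-lipschitz_on S f" and "S \<noteq> {}"
  obtains g where "L-lipschitz_on UNIV g" "\<And>x. x \<in> S \<Longrightarrow> g x = f x"
proof -
  have L: "L \<ge> 0" using lip lipschitz_on_nonneg by blast
  define g where "g x = (INF s\<in>S. f s + L * dist x s)" for x
  obtain s\<^sub>0 where s0: "s\<^sub>0 \<in> S" using assms(2) by blast
  \<comment> \<open>A downward cone at \<open>s\<^sub>0\<close> lies below all the upward cones, so
    the infima are finite.\<close>
  have below: "f s\<^sub>0 - L * dist x s\<^sub>0 \<le> f s + L * dist x s" if "s \<in> S" for x s
  proof -
    have "f s\<^sub>0 - f s \<le> L * dist s\<^sub>0 s" using lipschitz_onD[OF lip s0 that] by (simp add: dist_real_def)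
    also have "\<dots> \<le> L * (dist x s\<^sub>0 + dist x s)" using L dist_triangle3[of s\<^sub>0 s x] by (intro mult_left_mono)
    finally show ?thesis by (simp add: algebra_simps)
  qed
  have bdd: "bdd_below ((\<lambda>s. f s + L * dist x s) ` S)" for x
    using below by (intro bdd_belowI2)
  have step: "g x \<le> g y + L * dist x y" for x y
  proof -
    have "g x - L * dist x y \<le> g y"
      unfolding g_def[of y]
    proof (rule cINF_greatest[OF assms(2)])
      fix s assume s: "s \<in> S"
      have "g x \<le> f s + L * dist x s" unfolding g_def using bdd s by (rule cINF_lower)
      also have "\<dots> \<le> f s + L * (dist x y + dist y s)"
        using L dist_triangle[of x s y] by (intro add_left_mono mult_left_mono)
      finally show "g x - L * dist x y \<le> f s + L * dist y s" by (simp add: algebra_simps)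
    qed
    then show ?thesis by simp
  qed
  have "L-lipschitz_on UNIV g"
  proof (rule lipschitz_onI)
    fix x y show "dist (g x) (g y) \<le> L * dist x y"
      using step[of x y] step[of y x] by (simp add: dist_real_def dist_commute abs_le_iff)
  qed (rule L)
  moreover have "g x = f x" if x: "x \<in> S" for x
  proof (rule antisym)
    show "g x \<le> f x" unfolding g_def using cINF_lower[OF bdd x, of x] by simp
    show "f x \<le> g x" unfolding g_def
    proof (rule cINF_greatest[OF assms(2)])
      fix s assume "s \<in> S"
      then show "f x \<le> f s + L * dist x s" using lipschitz_onD[OF lip x, of s] by (simp add: dist_real_def)
    qed
  qed
  ultimately show ?thesis using that by blast
qed

section \<open>The oscillating graph and its ascending arcs near a line\<close>

definition osc :: "real \<Rightarrow> real \<Rightarrow> real" where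
  "osc \<alpha> x = x powr \<alpha> * sin (1 / x)"

lemma isCont_osc: "x > 0 \<Longrightarrow> isCont (osc \<alpha>) x"
  unfolding osc_def by (intro continuous_intros) auto

lemma osc_set_graph: "0 < x \<Longrightarrow> x < t\<^sub>0 \<Longrightarrow> (x, osc \<alpha> x) \<in> osc_set t\<^sub>0 \<alpha>"
  unfolding osc_set_def osc_def by (rule subsetD[OF closure_subset]) auto

text \<open>By continuity of \<open>osc \<alpha>\<close> at positive abscissae, taking the closure
  adds points off the graph only on the vertical axis.\<close>

lemma osc_set_eq_graph:
  assumes "(x, y) \<in> osc_set t\<^sub>0 \<alpha>" "x > 0"
  shows "y = osc \<alpha> x"
proof -
  obtain p where p: "\<And>n. p n \<in> (\<lambda>t. (t, osc \<alpha> t)) ` {0<..<t\<^sub>0}" "p \<longlonglongrightarrow> (x, y)"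
    using assms(1) unfolding osc_set_def closure_sequential osc_def by blast
  have "snd (p n) = osc \<alpha> (fst (p n))" for n using p(1)[of n] by auto
  moreover have "(\<lambda>n. osc \<alpha> (fst (p n))) \<longlonglongrightarrow> osc \<alpha> x"
    using tendsto_fst[OF p(2)] isCont_osc[OF assms(2)] by (auto intro: isCont_tendsto_compose)
  moreover have "(\<lambda>n. snd (p n)) \<longlonglongrightarrow> y" using tendsto_snd[OF p(2)] by simp
  ultimately show ?thesis using LIMSEQ_unique by simp
qed

text \<open>The sign conditions say that \<open>1 / x\<close> lies in the second quadrant, where \<open>osc \<alpha>\<close> increases
  with \<open>x\<close>; the window \<open>x\<^sup>2 / 2\<close> is small compared with the distance of about \<open>2 * pi * x\<^sup>2\<close>
  between consecutive oscillations.\<close>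

definition ascending :: "real \<Rightarrow> real \<Rightarrow> real set" where
  "ascending \<alpha> m = {x. 0 < x \<and> \<bar>osc \<alpha> x - m * x\<bar> \<le> x\<^sup>2 / 2 \<and> sin (1 / x) \<ge> 0 \<and> cos (1 / x) \<le> 0}"

lemma second_quadrant_cases:
  assumes "sin \<theta> \<ge> 0" "cos \<theta> \<le> 0"
  obtains k :: int and r :: real where "\<theta> = 2 * pi * k + r" "pi / 2 \<le> r" "r \<le> pi"
proof -
  define k where "k = \<lfloor>\<theta> / (2 * pi)\<rfloor>"
  define r where "r = \<theta> - 2 * pi * k"
  have "of_int k \<le> \<theta> / (2 * pi)" "\<theta> / (2 * pi) < of_int k + 1" unfolding k_def by linarith+
  then have "0 \<le> r" "r < 2 * pi" unfolding r_def by (auto simp: field_simps)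
  have "sin r = sin \<theta>" "cos r = cos \<theta>"
    using sin_cos_eq_iff[of r \<theta>] r_def by (auto simp: sin_diff cos_diff)
  have "r \<le> pi"
    using sin_lt_zero[of r] \<open>sin r = sin \<theta>\<close> assms(1) \<open>r < 2 * pi\<close> by force
  moreover have "pi / 2 \<le> r"
    using cos_gt_zero[of r] \<open>cos r = cos \<theta>\<close> assms(2) \<open>0 \<le> r\<close> by (cases "r = 0") force+
  ultimately show ?thesis using that[of k r] by (simp add: r_def)
qed

text \<open>Makes \<open>x\<close> a 2-Lipschitz function of \<open>x + osc \<alpha> x\<close> on
  the ascending set. Within one oscillation \<open>osc \<alpha>\<close> increases with
  \<open>x\<close>. In different oscillations both points are close to the line of slope
  \<open>m \<ge> 0\<close>, and their distance outweighs the two window errors.\<close>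

lemma ascending_separated:
  assumes "\<alpha> \<ge> 0" "m \<ge> 0" and x: "x \<in> ascending \<alpha> m" "x' \<in> ascending \<alpha> m" "x < x'" "x' \<le> 1/8"
  shows "(x' - x) / 2 \<le> (x' + osc \<alpha> x') - (x + osc \<alpha> x)"
proof -
  have pos: "0 < x" "0 < x'" using x unfolding ascending_def by auto
  obtain k r where k: "1 / x = 2 * pi * of_int k + r" "pi / 2 \<le> r" "r \<le> pi"
    using second_quadrant_cases[of "1/x"] x unfolding ascending_def by auto
  obtain k' r' where k': "1 / x' = 2 * pi * of_int k' + r'" "pi / 2 \<le> r'" "r' \<le> pi"
    using second_quadrant_cases[of "1/x'"] x unfolding ascending_def by auto
  have inv: "1 / x' < 1 / x" using pos x(3) by (simp add: frac_less2)
  show ?thesis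
  proof (cases "k = k'")
    case True
    then have "r' < r" using inv k k' by simp
    \<comment> \<open>In the second quadrant sine decreases with the angle; a shift by
      \<open>pi / 2\<close> reduces this to the monotonicity of cosine.\<close>
    then have "cos (r - pi / 2) \<le> cos (r' - pi / 2)"
      using k k' by (intro cos_monotone_0_pi_le) auto
    then have "sin r \<le> sin r'" by (simp add: cos_diff)
    moreover have "sin (1 / x) = sin r" "sin (1 / x') = sin r'"
      unfolding k k' by (simp_all add: sin_add)
    ultimately have "osc \<alpha> x \<le> osc \<alpha> x'"
      using x pos assms(1) unfolding osc_def ascending_def
      by (intro mult_mono powr_mono2) auto
    then show ?thesis using x(3) by simp
  next
    case False
    have "\<not> k < k'"
    proof
      assume "k < k'"
      then have "of_int k \<le> (of_int k' - 1 :: real)" by linarith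
      then have "2 * pi * of_int k \<le> 2 * pi * (of_int k' - 1)" by (intro mult_left_mono) auto
      then show False using inv k k' by (simp add: algebra_simps)
    qed
    then have "of_int k' \<le> (of_int k - 1 :: real)" using False by linarith
    then have "2 * pi * of_int k' \<le> 2 * pi * (of_int k - 1)" by (intro mult_left_mono) auto
    \<comment> \<open>At least one full turn \<open>2 * pi\<close>, less the quadrant width
      \<open>pi / 2\<close>.\<close>
    then have "1 / x - 1 / x' \<ge> 3 * pi / 2" using k k' by (simp add: algebra_simps)
    then have "1 / x - 1 / x' \<ge> 4" using pi_gt3 by linarith
    then have "(1 / x - 1 / x') * (x * x') \<ge> 4 * (x * x')" using pos by (intro mult_right_mono) auto
    moreover have "(1 / x - 1 / x') * (x * x') = x' - x" using pos by (simp add: field_simps)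
    ultimately have gap: "x' - x \<ge> 4 * (x * x')" by simp
    \<comment> \<open>The two window errors add up to at most \<open>x'\<^sup>2\<close>, so this
      leaves half of \<open>x' - x\<close>. The gap estimate serves when \<open>x\<close> and
      \<open>x'\<close> are comparable; otherwise \<open>x' - x\<close> exceeds
      \<open>x' / 2\<close> and \<open>x' \<le> 1/8\<close> suffices.\<close>
    have "x'\<^sup>2 \<le> (x' - x) / 2"
    proof (cases "x' \<le> 2 * x")
      case True
      then have "x' * x' \<le> 2 * x * x'" using pos by (intro mult_right_mono) auto
      then show ?thesis using gap by (simp add: power2_eq_square)
    next
      case False
      have "x' * x' \<le> x' * (1/8)" using x pos by (intro mult_left_mono) auto
      then have "x'\<^sup>2 \<le> x' / 8" by (simp add: power2_eq_square)
      also have "x' / 8 \<le> (x' - x) / 2" using False pos by (simp add: field_simps)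
      finally show ?thesis .
    qed
    moreover have "x\<^sup>2 \<le> x'\<^sup>2" using pos x(3) by (intro power_mono) auto
    moreover have "m * x \<le> m * x'" using assms x by (intro mult_left_mono) auto
    moreover have err: "\<bar>osc \<alpha> x' - m * x'\<bar> \<le> x'\<^sup>2 / 2" "\<bar>osc \<alpha> x - m * x\<bar> \<le> x\<^sup>2 / 2"
      using x unfolding ascending_def by auto
    moreover have "osc \<alpha> x' \<ge> m * x' - x'\<^sup>2 / 2" "osc \<alpha> x \<le> m * x + x\<^sup>2 / 2"
      using err by linarith+
    ultimately show ?thesis by (simp add: field_simps)
  qed
qed

text \<open>In the turn containing \<open>1 / y\<close>, the second quadrant takes
  \<open>osc \<alpha>\<close> from 0 to its envelope \<open>x powr \<alpha>\<close>, which lies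
  above the line; the intermediate value theorem gives a crossing \<open>a\<close>, and continuity a
  short arc to its right. As \<open>1 / a\<close> and \<open>1 / y\<close> belong to the same turn,
  \<open>a\<close> differs from \<open>y\<close> only by order \<open>y\<^sup>2\<close>.\<close>

lemma ascending_arc_near:
  assumes "\<alpha> \<ge> 0" "m \<ge> 0" "m = 0 \<or> m < 1 \<and> \<alpha> \<le> 1" and y: "0 < y" "y \<le> 1 / (4 * pi)"
  obtains a b where "0 < a" "a < b" "b \<le> 2 * y" "{a..b} \<subseteq> ascending \<alpha> m" "osc \<alpha> a = m * a"
    "\<bar>a - y\<bar> \<le> 4 * pi * y\<^sup>2"
proof -
  \<comment> \<open>Index of the full turn that contains \<open>1 / y\<close>; the bound
    \<open>y \<le> 1 / (4 * pi)\<close> forces \<open>k > 0\<close>.\<close>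
  define k where "k = nat \<lfloor>1 / (2 * pi * y)\<rfloor>"
  have "0 \<le> 1 / (2 * pi * y)" using y by simp
  then have "real k \<le> 1 / (2 * pi * y)" "1 / (2 * pi * y) < real k + 1"
    unfolding k_def by linarith+
  then have k: "2 * pi * k \<le> 1 / y" "1 / y < 2 * pi * k + 2 * pi" using y by (auto simp: field_simps)
  have y4: "4 * pi \<le> 1 / y" using y by (simp add: field_simps)
  have "1 / (2 * y) \<le> 1 / y - 2 * pi" using y4 by (simp add: field_simps)
  then have k2: "1 / (2 * y) \<le> 2 * pi * k" using k by linarith
  have "0 < 1 / (2 * y)" using y by simp
  then have kpos: "2 * pi * k > 0" using k2 by linarith
  have period: "sin (2 * pi * real k) = 0" "cos (2 * pi * real k) = 1"
    using sin_2npi[of k] cos_2npi[of k] by (simp_all add: mult.commute mult.left_commute)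
  \<comment> \<open>Reciprocals reverse the order: the angle \<open>pi\<close> gives the left end
    \<open>x0\<close>, where the sine vanishes, and \<open>pi / 2\<close> the right end
    \<open>x1\<close>, where it equals 1.\<close>
  define x0 x1 where "x0 = 1 / (2 * pi * k + pi)" and "x1 = 1 / (2 * pi * k + pi / 2)"
  have x01: "0 < x0" "x0 < x1" using kpos unfolding x0_def x1_def by (auto intro!: frac_less2 add_pos_pos)
  have "real k > 0" using kpos by (simp add: zero_less_mult_iff)
  then have "2 * pi * k \<ge> 2 * pi * 1" by (intro mult_left_mono) auto
  then have "1 \<le> 2 * pi * k + pi / 2" using pi_gt3 by linarith
  then have "x1 \<le> 1" unfolding x1_def by (simp add: divide_le_eq)
  have "x1 \<le> 1 / (1 / (2 * y))"
    unfolding x1_def using k2 y pi_gt_zero by (intro frac_le) (simp, simp, simp, linarith)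
  then have x1y: "x1 \<le> 2 * y" by simp
  have range: "2 * pi * k + pi / 2 \<le> 1 / x" "1 / x \<le> 2 * pi * k + pi" if "x0 \<le> x" "x \<le> x1" for x
  proof -
    have "0 < x" using that x01 by simp
    have "1 / x1 \<le> 1 / x" using that(2) \<open>0 < x\<close> by (intro frac_le) auto
    then show "2 * pi * k + pi / 2 \<le> 1 / x" unfolding x1_def by simp
    have "1 / x \<le> 1 / x0" using that(1) x01 by (intro frac_le) auto
    then show "1 / x \<le> 2 * pi * k + pi" unfolding x0_def by simp
  qed
  have signs: "sin (1 / x) \<ge> 0 \<and> cos (1 / x) \<le> 0" if "x0 \<le> x" "x \<le> x1" for x
  proof -
    define r where "r = 1 / x - 2 * pi * k"
    have r: "pi / 2 \<le> r" "r \<le> pi" using range[OF that] unfolding r_def by auto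
    have "1 / x = r + 2 * pi * k" unfolding r_def by simp
    then have "sin (1 / x) = sin r" "cos (1 / x) = cos r" by (simp_all add: sin_add cos_add period)
    moreover have "sin r \<ge> 0" using r by (intro sin_ge_zero) auto
    moreover have "cos r \<le> cos (pi / 2)" using r by (intro cos_monotone_0_pi_le) auto
    ultimately show ?thesis by simp
  qed
  define h where "h x = osc \<alpha> x - m * x" for x
  have cont: "isCont h x" if "x > 0" for x
    unfolding h_def using isCont_osc[OF that] by (intro continuous_intros)
  have "h x0 \<le> 0" using x01 assms(2) unfolding h_def osc_def x0_def by (simp add: sin_add period)
  moreover have "h x1 > 0"
  proof -
    have "sin (1 / x1) = 1" unfolding x1_def by (simp add: sin_add period)
    then have "h x1 = x1 powr \<alpha> - m * x1" unfolding h_def osc_def by simp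
    moreover have "m * x1 < x1 powr \<alpha>"
    \<comment> \<open>For \<open>m \<noteq> 0\<close>, \<open>x1 \<le> 1\<close> and
      \<open>\<alpha> \<le> 1\<close> give \<open>x1 \<le> x1 powr \<alpha>\<close>, and
      \<open>m < 1\<close> makes the comparison strict.\<close>
    proof (cases "m = 0")
      case False
      then have "m * x1 < x1 powr 1" using assms x01 by simp
      also have "\<dots> \<le> x1 powr \<alpha>" using False assms x01 \<open>x1 \<le> 1\<close> by (intro powr_mono') auto
      finally show ?thesis .
    qed (use x01 in simp)
    ultimately show ?thesis by simp
  qed
  ultimately obtain a where a: "x0 \<le> a" "a \<le> x1" "h a = 0"
    using IVT[of h x0 0 x1] x01 cont by force
  then have a': "0 < a" "a < x1" using x01 \<open>h x1 > 0\<close> by (auto simp: less_le)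
  \<comment> \<open>The tolerance is measured at the left end \<open>a\<close>, because the window
    \<open>x\<^sup>2 / 2\<close> only widens to the right.\<close>
  have "eventually (\<lambda>x. dist (h x) (h a) < a\<^sup>2 / 2) (at a)"
    using cont[OF a'(1)] a' unfolding isCont_def by (intro tendstoD) auto
  then obtain d where d: "d > 0" "\<And>x. x \<noteq> a \<Longrightarrow> dist x a < d \<Longrightarrow> dist (h x) (h a) < a\<^sup>2 / 2"
    unfolding eventually_at by auto
  define b where "b = min x1 (a + d / 2)"
  have b: "a < b" "b \<le> x1" using a' d unfolding b_def by auto
  have "{a..b} \<subseteq> ascending \<alpha> m"
  proof
    fix x assume x: "x \<in> {a..b}"
    have "\<bar>h x\<bar> \<le> a\<^sup>2 / 2"
    proof (cases "x = a")
      case False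
      then have "dist (h x) (h a) < a\<^sup>2 / 2"
        using x d unfolding b_def by (intro d(2)) (auto simp: dist_real_def)
      then show ?thesis using a by (simp add: dist_real_def)
    qed (use a in simp)
    also have "a\<^sup>2 \<le> x\<^sup>2" using x a' by (intro power_mono) auto
    finally have "\<bar>h x\<bar> \<le> x\<^sup>2 / 2" by simp
    then show "x \<in> ascending \<alpha> m"
      using signs[of x] x a a' b unfolding ascending_def h_def by auto
  qed
  moreover have "\<bar>a - y\<bar> \<le> 4 * pi * y\<^sup>2"
  proof -
    have "\<bar>1 / y - 1 / a\<bar> \<le> 2 * pi"
      using range[OF a(1,2)] k pi_gt_zero by (simp add: abs_le_iff)
    moreover have "a - y = a * y * (1 / y - 1 / a)" using a' y by (simp add: field_simps)
    ultimately have "\<bar>a - y\<bar> \<le> a * y * (2 * pi)"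
      using a' y by (simp add: abs_mult)
    also have "\<dots> \<le> (2 * y) * y * (2 * pi)" using a x1y y by (intro mult_right_mono) auto
    finally show ?thesis by (simp add: power2_eq_square mult_ac)
  qed
  ultimately show ?thesis using that[of a b] a a' b x1y unfolding h_def by auto
qed

section \<open>Probes with a prescribed tangent slope\<close>

lemma limit_direction_sgn:
  assumes "((\<lambda>t. (\<gamma> t - x) /\<^sub>R t) \<longlongrightarrow> w) (at_right 0)" "w \<noteq> 0"
  shows "limit_direction \<gamma> x (sgn w)"
proof -
  have "((\<lambda>t. sgn ((\<gamma> t - x) /\<^sub>R t)) \<longlongrightarrow> sgn w) (at_right 0)"
    using assms by (intro tendsto_sgn)
  moreover have "eventually (\<lambda>t. sgn ((\<gamma> t - x) /\<^sub>R t) = (\<gamma> t - x) /\<^sub>R norm (\<gamma> t - x)) (at_right 0)"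
    using eventually_at_right_0_less_1 by eventually_elim (simp add: sgn_scaleR sgn_div_norm)
  ultimately show ?thesis unfolding limit_direction_def by (simp add: tendsto_cong)
qed

text \<open>The abscissa, as a function of \<open>x + osc \<alpha> x\<close> on the ascending set,
  extends to a Lipschitz function \<open>X\<close>. The probe has abscissa \<open>X s\<close> and
  coordinate sum \<open>s\<close>, hence is automatically injective. For its tangent, every small
  \<open>s\<close> has a crossing with the line within order \<open>s\<^sup>2\<close>, and there
  \<open>X\<close> is exact.\<close>

lemma probe_through_ascending:
  assumes "\<alpha> \<ge> 0" "m \<ge> 0" "m = 0 \<or> m < 1 \<and> \<alpha> \<le> 1" "d > 0" "d \<le> 1/8"
  obtains \<gamma> L where "L-lipschitz_on UNIV \<gamma>" "inj \<gamma>" "\<gamma> 0 = 0"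
    "limit_direction \<gamma> 0 (sgn (1, m))"
    "\<And>x. x \<in> ascending \<alpha> m \<Longrightarrow> x < d \<Longrightarrow> \<gamma> (x + osc \<alpha> x) = (x, osc \<alpha> x)"
proof -
  \<comment> \<open>The origin is a node too; this forces \<open>X 0 = 0\<close>, so that the probe
    starts there.\<close>
  define P where "P = insert 0 (ascending \<alpha> m \<inter> {..<d})"
  define u where "u x = x + osc \<alpha> x" for x
  have u0: "u 0 = 0" unfolding u_def osc_def by simp
  have sep: "x' - x \<le> 2 * (u x' - u x)" if "x \<in> P" "x' \<in> P" "x < x'" for x x'
  proof (cases "x = 0")
    case True
    then have "x' \<in> ascending \<alpha> m" using that unfolding P_def by auto
    then have "osc \<alpha> x' \<ge> 0" "x' > 0" unfolding ascending_def osc_def by auto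
    then show ?thesis using u0 True unfolding u_def by simp
  next
    case False
    moreover have "x' \<noteq> 0" using that unfolding P_def ascending_def by auto
    ultimately have "(x' - x) / 2 \<le> u x' - u x"
      unfolding u_def using that assms unfolding P_def by (intro ascending_separated[where m = m]) auto
    then show ?thesis by simp
  qed
  have dist_u: "dist x x' \<le> 2 * dist (u x) (u x')" if "x \<in> P" "x' \<in> P" for x x'
    using sep[of x x'] sep[of x' x] that by (cases x x' rule: linorder_cases) (auto simp: dist_real_def)
  then have "inj_on u P" by (intro inj_onI) (metis dist_self mult_zero_right dist_le_zero_iff)
  then have inv: "the_inv_into P u (u x) = x" if "x \<in> P" for x
    using that by (rule the_inv_into_f_f)
  have "2-lipschitz_on (u ` P) (the_inv_into P u)"
    using dist_u inv by (intro lipschitz_onI) auto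
  moreover have "u ` P \<noteq> {}" unfolding P_def by simp
  ultimately obtain X where X: "2-lipschitz_on UNIV X" "\<And>s. s \<in> u ` P \<Longrightarrow> X s = the_inv_into P u s"
    using lipschitz_extension_real by blast
  have Xu: "X (u x) = x" if "x \<in> P" for x using X(2)[of "u x"] inv that by auto
  have X0: "X 0 = 0" using Xu[of 0] u0 unfolding P_def by simp
  define \<gamma> where "\<gamma> s = (X s, s - X s)" for s
  \<comment> \<open>The point \<open>(y, m * y)\<close> of the line has coordinate sum
    \<open>c * y\<close>, so \<open>s / c\<close> is the abscissa expected at parameter
    \<open>s\<close>.\<close>
  define c where "c = 1 + m"
  have c: "c \<ge> 1" using assms unfolding c_def by simp
  define C where "C = (2 * c + 1) * (4 * pi)"
  have near: "\<bar>X s - s / c\<bar> \<le> C * (s / c)\<^sup>2" if s: "0 < s" "s / c < d / 2" for s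
  proof -
    define y where "y = s / c"
    have "s = c * y" "0 < y" using c s unfolding y_def by auto
    have "d * (4 * pi) \<le> 1 / 8 * (4 * 4)" using assms pi_less_4 by (intro mult_mono) auto
    then have "d \<le> 2 / (4 * pi)" using pi_gt_zero by (simp add: field_simps)
    then have "y \<le> 1 / (4 * pi)" using s unfolding y_def by simp
    then obtain a b where a: "0 < a" "a < b" "b \<le> 2 * y" "{a..b} \<subseteq> ascending \<alpha> m" "osc \<alpha> a = m * a"
      "\<bar>a - y\<bar> \<le> 4 * pi * y\<^sup>2"
      using ascending_arc_near[OF assms(1-3) \<open>0 < y\<close>] by metis
    \<comment> \<open>The crossing satisfies \<open>a < b \<le> 2 * y\<close>, so the restriction
      \<open>s / c < d / 2\<close> keeps it among the nodes.\<close>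
    have "y < d / 2" using s unfolding y_def by simp
    then have "a < d" using a by linarith
    then have "a \<in> P" using a unfolding P_def by auto
    have "u a = c * a" unfolding u_def c_def a(5) by (simp add: algebra_simps)
    then have "X (c * a) = a" using Xu[OF \<open>a \<in> P\<close>] by simp
    \<comment> \<open>The crossing error enters twice, through the Lipschitz bound for
      \<open>X\<close> and directly, whence the factor \<open>2 * c + 1\<close>.\<close>
    have "\<bar>X s - y\<bar> \<le> \<bar>X s - X (c * a)\<bar> + \<bar>a - y\<bar>" unfolding \<open>X (c * a) = a\<close> by simp
    also have "\<bar>X s - X (c * a)\<bar> \<le> 2 * \<bar>s - c * a\<bar>"
      using lipschitz_onD[OF X(1), of s "c * a"] by (simp add: dist_real_def)
    also have "\<bar>s - c * a\<bar> = c * \<bar>a - y\<bar>"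
      unfolding \<open>s = c * y\<close> using c by (simp add: abs_mult abs_minus_commute flip: right_diff_distrib)
    also have "2 * (c * \<bar>a - y\<bar>) + \<bar>a - y\<bar> = (2 * c + 1) * \<bar>a - y\<bar>" by (simp add: algebra_simps)
    also have "\<dots> \<le> (2 * c + 1) * (4 * pi * y\<^sup>2)" using a c by (intro mult_left_mono) auto
    finally show ?thesis unfolding C_def y_def by (simp add: algebra_simps)
  qed
  have "((\<lambda>s. X s / s - 1 / c) \<longlongrightarrow> 0) (at_right 0)"
  proof (rule Lim_null_comparison)
    have "eventually (\<lambda>s. 0 < s \<and> s < d / 2 * c) (at_right 0)"
      using c assms by (intro eventually_at_rightI[of 0 "d / 2 * c"]) auto
    then show "eventually (\<lambda>s. norm (X s / s - 1 / c) \<le> C * (s / c\<^sup>2)) (at_right 0)"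
    proof eventually_elim
      case (elim s)
      have "\<bar>X s / s - 1 / c\<bar> = \<bar>X s - s / c\<bar> / s" using elim c
        by (simp add: abs_if field_simps)
      also have "\<dots> \<le> C * (s / c)\<^sup>2 / s" using elim c
        by (intro divide_right_mono near) (auto simp: field_simps)
      finally show ?case using elim by (simp add: power2_eq_square)
    qed
    show "((\<lambda>s. C * (s / c\<^sup>2)) \<longlongrightarrow> 0) (at_right 0)"
      using c by (auto intro!: tendsto_eq_intros)
  qed
  then have lim: "((\<lambda>s. X s / s) \<longlongrightarrow> 1 / c) (at_right 0)" by (rule LIM_zero_cancel)
  have "((\<lambda>s. (X s / s, 1 - X s / s)) \<longlongrightarrow> (1 / c, 1 - 1 / c)) (at_right 0)"
    by (intro tendsto_intros lim)
  moreover have "eventually (\<lambda>s. (X s / s, 1 - X s / s) = (\<gamma> s - 0) /\<^sub>R s) (at_right 0)"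
    using eventually_at_right_0_less_1
    by eventually_elim (simp add: \<gamma>_def divide_inverse algebra_simps)
  ultimately have "((\<lambda>s. (\<gamma> s - 0) /\<^sub>R s) \<longlongrightarrow> (1 / c, 1 - 1 / c)) (at_right 0)"
    by (simp only: tendsto_cong)
  then have "limit_direction \<gamma> 0 (sgn (1 / c, 1 - 1 / c))"
    using c by (intro limit_direction_sgn) (simp_all add: zero_prod_def)
  moreover have "(1 / c, 1 - 1 / c) = (1 / c) *\<^sub>R (1, m)"
    using c unfolding c_def by (simp add: field_simps)
  then have "sgn (1 / c, 1 - 1 / c) = sgn (1, m)" using c by (simp only: sgn_scaleR) simp
  ultimately have "limit_direction \<gamma> 0 (sgn (1, m))" by simp
  moreover have "inj \<gamma>" unfolding \<gamma>_def by (intro injI) auto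
  moreover have "\<gamma> 0 = 0" unfolding \<gamma>_def X0 by (simp add: zero_prod_def)
  moreover have "\<exists>L. L-lipschitz_on UNIV \<gamma>"
    unfolding \<gamma>_def using lipschitz_on_Pair[OF X(1) lipschitz_on_diff[OF lipschitz_on_id X(1)]] by blast
  moreover have "\<gamma> (x + osc \<alpha> x) = (x, osc \<alpha> x)" if "x \<in> ascending \<alpha> m" "x < d" for x
    using Xu[of x] that unfolding \<gamma>_def P_def u_def by simp
  ultimately show ?thesis using that by blast
qed

lemma proj_class_scaleR: "c \<noteq> 0 \<Longrightarrow> proj_class (c *\<^sub>R v) = proj_class v"
  unfolding proj_class_def using span_image_scale[of "{v}" "\<lambda>_. c"] by simp

lemma proj_class_sgn [simp]: "proj_class (sgn v) = proj_class v"
  using proj_class_scaleR[of "inverse (norm v)" v] unfolding sgn_div_norm by (cases "v = 0") auto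

lemma ascending_arc_small:
  assumes "\<alpha> \<ge> 0" "m \<ge> 0" "m = 0 \<or> m < 1 \<and> \<alpha> \<le> 1" and r: "r > 0"
  obtains a b where "0 < a" "a < b"
    "\<And>x. x \<in> {a..b} \<Longrightarrow> x \<in> ascending \<alpha> m \<and> osc \<alpha> x \<ge> 0 \<and> x + osc \<alpha> x < r"
proof -
  \<comment> \<open>On the arc, \<open>x \<le> 2 * y\<close> and
    \<open>osc \<alpha> x \<le> m * x + x / 2\<close>, so
    \<open>x + osc \<alpha> x \<le> (3 + 2 * m) * y\<close>; the larger constant
    \<open>6 + 2 * m\<close> makes the final bound strict.\<close>
  define y where "y = min (1 / (4 * pi)) (r / (6 + 2 * m))"
  have y: "0 < y" "y \<le> 1 / (4 * pi)" "y \<le> r / (6 + 2 * m)" using r assms(2) unfolding y_def by auto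
  then have "y * (6 + 2 * m) \<le> r" using assms(2) by (simp add: pos_le_divide_eq)
  obtain a b where ab: "0 < a" "a < b" "b \<le> 2 * y" "{a..b} \<subseteq> ascending \<alpha> m"
    using ascending_arc_near[OF assms(1-3) y(1,2)] by metis
  have "y \<le> 1 / 8" using y(2) pi_gt3 by (elim order_trans) (simp add: field_simps)
  have "x \<in> ascending \<alpha> m \<and> osc \<alpha> x \<ge> 0 \<and> x + osc \<alpha> x < r" if "x \<in> {a..b}" for x
  proof -
    have x: "x \<in> ascending \<alpha> m" "0 < x" "x \<le> 2 * y" using ab that by auto
    have "\<bar>osc \<alpha> x - m * x\<bar> \<le> x\<^sup>2 / 2" using x unfolding ascending_def by auto
    moreover have "x * x \<le> x * 1" using x \<open>y \<le> 1/8\<close> by (intro mult_left_mono) auto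
    ultimately have "x + osc \<alpha> x \<le> x + m * x + x / 2" unfolding power2_eq_square by linarith
    also have "\<dots> = x * (3 / 2 + m)" by (simp add: algebra_simps)
    also have "\<dots> \<le> (2 * y) * (3 / 2 + m)" using x assms by (intro mult_right_mono) auto
    also have "\<dots> < y * (6 + 2 * m)" using y by (simp add: algebra_simps)
    finally have "x + osc \<alpha> x < r" using \<open>y * (6 + 2 * m) \<le> r\<close> by linarith
    then show ?thesis using x unfolding ascending_def osc_def by auto
  qed
  then show ?thesis using that ab by blast
qed

section \<open>Effective directions at the origin and their contributions\<close>

lemma zero_in_osc_set:
  assumes "t\<^sub>0 > 0" "\<alpha> \<ge> 0"
  shows "0 \<in> osc_set t\<^sub>0 \<alpha>"
proof -
  have "\<exists>p\<in>osc_set t\<^sub>0 \<alpha>. dist p 0 < r" if "r > 0" for r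
  proof -
    obtain a b where a: "0 < a" "a < b"
      "\<And>x. x \<in> {a..b} \<Longrightarrow> x \<in> ascending \<alpha> 0 \<and> osc \<alpha> x \<ge> 0 \<and> x + osc \<alpha> x < min r t\<^sub>0"
      using ascending_arc_small[of \<alpha> 0 "min r t\<^sub>0"] assms \<open>r > 0\<close> by (metis min_less_iff_conj order_refl)
    have "a \<in> {a..b}" using a(2) by simp
    then have "osc \<alpha> a \<ge> 0" "a + osc \<alpha> a < r" "a + osc \<alpha> a < t\<^sub>0" using a(3) by fastforce+
    moreover have "dist (a, osc \<alpha> a) 0 \<le> \<bar>a\<bar> + \<bar>osc \<alpha> a\<bar>"
      using norm_Pair_le[of a "osc \<alpha> a"] by (simp add: dist_norm)
    ultimately show ?thesis using osc_set_graph[of a t\<^sub>0 \<alpha>] a(1)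
      by (intro bexI[of _ "(a, osc \<alpha> a)"]) auto
  qed
  then have "0 \<in> closure (osc_set t\<^sub>0 \<alpha>)" unfolding closure_approachable by blast
  then show ?thesis unfolding osc_set_def by simp
qed

text \<open>Arbitrarily near the origin the probe contains an arc of the set whose abscissae fill an
  interval; such an arc has upper box dimension at least 1, however short it is.\<close>

lemma dir_contribution_osc_set:
  assumes "t\<^sub>0 > 0" "\<alpha> \<ge> 0" "m \<ge> 0" "m = 0 \<or> m < 1 \<and> \<alpha> \<le> 1"
  shows "dir_contribution (osc_set t\<^sub>0 \<alpha>) 0 (sgn (1, m)) = 1"
proof (rule antisym[OF dir_contribution_le_1])
  let ?A = "osc_set t\<^sub>0 \<alpha>"
  have pos: "(0 :: real) < 1/8" "1/8 \<le> (1/8 :: real)" by simp_all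
  obtain \<gamma> L where \<gamma>: "L-lipschitz_on UNIV \<gamma>" "inj \<gamma>" "\<gamma> 0 = 0" "limit_direction \<gamma> 0 (sgn (1, m))"
    "\<And>x. x \<in> ascending \<alpha> m \<Longrightarrow> x < 1/8 \<Longrightarrow> \<gamma> (x + osc \<alpha> x) = (x, osc \<alpha> x)"
    by (rule probe_through_ascending[OF assms(2-4) pos]) (rule that)
  define E where "E = ?A \<inter> \<gamma> ` {0..1}"
  have arc: "\<exists>a b. 0 < a \<and> a < b \<and> (\<forall>x\<in>{a..b}. (x, osc \<alpha> x) \<in> ?A \<inter> \<gamma> ` {0<..\<eta>} \<inter> ball 0 \<eta>)"
    if "\<eta> > 0" for \<eta>
  proof -
    \<comment> \<open>For \<open>osc \<alpha> x \<ge> 0\<close>, the sum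
      \<open>x + osc \<alpha> x\<close> is the probe parameter and bounds both \<open>x\<close> and
      the norm of the point. The three bounds place the point near the origin, where
      \<open>\<gamma>\<close> follows the graph, and inside the set.\<close>
    define r where "r = min \<eta> (min (1/8) t\<^sub>0)"
    have "r > 0" using assms \<open>\<eta> > 0\<close> unfolding r_def by simp
    then obtain a b where ab: "0 < a" "a < b"
      "\<And>x. x \<in> {a..b} \<Longrightarrow> x \<in> ascending \<alpha> m \<and> osc \<alpha> x \<ge> 0 \<and> x + osc \<alpha> x < r"
      using ascending_arc_small[OF assms(2-4)] by metis
    have "(x, osc \<alpha> x) \<in> ?A \<inter> \<gamma> ` {0<..\<eta>} \<inter> ball 0 \<eta>" if x: "x \<in> {a..b}" for x
    proof -
      have x': "0 < x" "x \<in> ascending \<alpha> m" "osc \<alpha> x \<ge> 0" "x + osc \<alpha> x < \<eta>"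
        "x + osc \<alpha> x < 1/8" "x + osc \<alpha> x < t\<^sub>0"
        using ab x unfolding r_def by force+
      have "(x, osc \<alpha> x) \<in> ?A" using x' by (intro osc_set_graph) auto
      moreover have "(x, osc \<alpha> x) = \<gamma> (x + osc \<alpha> x)" using \<gamma>(5) x' by simp
      then have "(x, osc \<alpha> x) \<in> \<gamma> ` {0<..\<eta>}" using x' by auto
      moreover have "norm (x, osc \<alpha> x) \<le> \<bar>x\<bar> + \<bar>osc \<alpha> x\<bar>" using norm_Pair_le[of x "osc \<alpha> x"] by simp
      then have "(x, osc \<alpha> x) \<in> ball 0 \<eta>" using x' by simp
      ultimately show ?thesis by blast
    qed
    then show ?thesis using ab by blast
  qed
  have "(1, \<gamma>) \<in> probes ?A 0 (sgn (1, m))"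
  proof -
    have "?A \<inter> \<gamma> ` {0<..\<eta>} \<noteq> {}" if "\<eta> > 0" for \<eta>
    proof -
      obtain a b where ab: "a < b" "\<forall>x\<in>{a..b}. (x, osc \<alpha> x) \<in> ?A \<inter> \<gamma> ` {0<..\<eta>} \<inter> ball 0 \<eta>"
        using arc[OF \<open>\<eta> > 0\<close>] by blast
      then have "(a, osc \<alpha> a) \<in> ?A \<inter> \<gamma> ` {0<..\<eta>}" by auto
      then show ?thesis by blast
    qed
    moreover have "inj_on \<gamma> {0..1}" using \<gamma>(2) by (rule inj_on_subset) simp
    moreover have "L-lipschitz_on {0..1} \<gamma>" using \<gamma>(1) by (rule lipschitz_on_subset) simp
    ultimately show ?thesis using \<gamma>(3,4) unfolding probes_def by auto
  qed
  then have "probe_contribution ?A 0 (1, \<gamma>) \<le> dir_contribution ?A 0 (sgn (1, m))"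
    unfolding dir_contribution_def by (rule SUP_upper)
  moreover have "1 \<le> pbox_dim E 0"
  proof -
    have "0 \<in> E" using zero_in_osc_set[OF assms(1,2)] \<gamma>(3) unfolding E_def by force
    then have "0 \<in> closure E" using closure_subset by blast
    moreover have "1 \<le> upper_box_dim (E \<inter> ball 0 r)" if "r > 0" for r
    proof -
      obtain a b where ab: "a < b"
        "\<And>x. x \<in> {a..b} \<Longrightarrow> (x, osc \<alpha> x) \<in> ?A \<inter> \<gamma> ` {0<..min r 1} \<inter> ball 0 (min r 1)"
        using arc[of "min r 1"] \<open>r > 0\<close> by auto
      have "(x, osc \<alpha> x) \<in> E \<inter> ball 0 r" if "x \<in> {a..b}" for x
        using ab(2)[OF that] unfolding E_def by auto
      then have "{a..b} \<subseteq> fst ` (E \<inter> ball 0 r)" by force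
      then show ?thesis using ab(1) by (intro upper_box_dim_ge_1) auto
    qed
    ultimately show ?thesis unfolding pbox_dim_def by (auto intro: INF_greatest)
  qed
  ultimately show "1 \<le> dir_contribution ?A 0 (sgn (1, m))"
    unfolding probe_contribution_def E_def by auto
qed

text \<open>The crossings \<open>a n\<close> lie exactly on the line. The tangent cone demands
  decreasing scales, which the \<open>a n\<close> themselves need not provide; the explicit
  \<open>y n\<close> do, and \<open>a n / y n\<close> tends to 1.\<close>

lemma sgn_in_eff_dirs_osc_set:
  assumes "t\<^sub>0 > 0" "\<alpha> \<ge> 0" "m \<ge> 0" "m = 0 \<or> m < 1 \<and> \<alpha> \<le> 1"
  shows "sgn (1, m) \<in> eff_dirs (osc_set t\<^sub>0 \<alpha>) 0"
proof -
  let ?A = "osc_set t\<^sub>0 \<alpha>"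
  \<comment> \<open>\<open>K\<close> enforces \<open>y n \<le> 1 / (4 * pi)\<close> and keeps the
    crossings, which lie below \<open>2 * y n\<close>, under \<open>t\<^sub>0\<close>.\<close>
  define K where "K = max (4 * pi) (4 / t\<^sub>0)"
  define y where "y n = 1 / (K + real n)" for n
  have K: "K > 0" "4 * pi \<le> K" "4 / t\<^sub>0 \<le> K" unfolding K_def by (auto simp: less_max_iff_disj)
  have y: "0 < y n" "y n \<le> 1 / (4 * pi)" "2 * y n < t\<^sub>0" for n
  proof -
    show "0 < y n" using K unfolding y_def by (simp add: add_pos_nonneg)
    show "y n \<le> 1 / (4 * pi)" using K unfolding y_def by (intro frac_le) auto
    have "y n \<le> 1 / (4 / t\<^sub>0)" unfolding y_def using K assms(1) by (intro frac_le) auto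
    then show "2 * y n < t\<^sub>0" using assms(1) by simp
  qed
  have "\<exists>a. 0 < a \<and> a < t\<^sub>0 \<and> osc \<alpha> a = m * a \<and> \<bar>a - y n\<bar> \<le> 4 * pi * (y n)\<^sup>2" for n
  proof -
    obtain a b where "0 < a" "a < b" "b \<le> 2 * y n" "osc \<alpha> a = m * a" "\<bar>a - y n\<bar> \<le> 4 * pi * (y n)\<^sup>2"
      using ascending_arc_near[OF assms(2-4) y(1,2)] by metis
    then show ?thesis using y(3)[of n] by (intro exI[of _ a]) auto
  qed
  then obtain a where a: "\<And>n. 0 < a n" "\<And>n. a n < t\<^sub>0" "\<And>n. osc \<alpha> (a n) = m * a n"
    "\<And>n. \<bar>a n - y n\<bar> \<le> 4 * pi * (y n)\<^sup>2" by metis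
  have ylim: "y \<longlonglongrightarrow> 0" unfolding y_def by real_asymp
  have ratio: "(\<lambda>n. a n / y n) \<longlonglongrightarrow> 1"
  proof -
    have "(\<lambda>n. a n / y n - 1) \<longlonglongrightarrow> 0"
    proof (rule Lim_null_comparison)
      show "eventually (\<lambda>n. norm (a n / y n - 1) \<le> 4 * pi * y n) sequentially"
      proof (rule always_eventually, rule allI)
        fix n
        have "norm (a n / y n - 1) = \<bar>a n - y n\<bar> / y n" using y(1)[of n] by (simp add: abs_if field_simps)
        also have "\<dots> \<le> 4 * pi * (y n)\<^sup>2 / y n" using a(4)[of n] y(1)[of n] by (intro divide_right_mono) auto
        finally show "norm (a n / y n - 1) \<le> 4 * pi * y n" using y(1)[of n] by (simp add: power2_eq_square)
      qed
      show "(\<lambda>n. 4 * pi * y n) \<longlonglongrightarrow> 0" using ylim by (auto intro!: tendsto_eq_intros)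
    qed
    then show ?thesis by (rule LIM_zero_cancel)
  qed
  have "(\<lambda>n. a n / y n * y n) \<longlonglongrightarrow> 1 * 0" by (intro tendsto_intros ratio ylim)
  moreover have "a n / y n * y n = a n" for n using y(1)[of n] by simp
  ultimately have alim: "a \<longlonglongrightarrow> 0" by simp
  have "sgn (1, m) \<in> tangent_cone ?A 0"
    unfolding tangent_cone_def
  proof (intro CollectI exI conjI allI)
    let ?N = "norm (1 :: real, m)"
    have N: "?N > 0" by (simp add: zero_prod_def)
    fix k
    show "(a k, m * a k) \<in> ?A" using osc_set_graph[of "a k" t\<^sub>0 \<alpha>] a by simp
    show "?N * y k > 0" using N y(1) by simp
    show "decseq (\<lambda>k. ?N * y k)"
      unfolding decseq_def y_def using K by (auto intro!: mult_left_mono frac_le add_pos_nonneg)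
    show "(\<lambda>k. ?N * y k) \<longlonglongrightarrow> 0" using ylim by (auto intro!: tendsto_eq_intros)
    show "(\<lambda>k. (a k, m * a k)) \<longlonglongrightarrow> 0"
      using alim unfolding zero_prod_def by (auto intro!: tendsto_eq_intros)
    have "(\<lambda>k. (a k / y k) *\<^sub>R sgn (1, m)) \<longlonglongrightarrow> 1 *\<^sub>R sgn (1, m)"
      by (intro tendsto_intros ratio)
    moreover have "((a k, m * a k) - 0) /\<^sub>R (?N * y k) = (a k / y k) *\<^sub>R sgn (1, m)" for k
      unfolding sgn_div_norm by (simp add: divide_inverse algebra_simps)
    ultimately show "(\<lambda>k. ((a k, m * a k) - 0) /\<^sub>R (?N * y k)) \<longlonglongrightarrow> sgn (1, m)" by simp
  qed
  moreover have "0 \<in> closure ?A" using zero_in_osc_set[OF assms(1,2)] closure_subset by blast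
  moreover have "norm (sgn (1 :: real, m)) = 1" by (simp add: norm_sgn zero_prod_def)
  ultimately show ?thesis unfolding eff_dirs_def by simp
qed

lemma proj_contribution_osc_set:
  assumes "t\<^sub>0 > 0" "\<alpha> \<ge> 0" "m \<ge> 0" "m = 0 \<or> m < 1 \<and> \<alpha> \<le> 1"
  shows "proj_contribution (osc_set t\<^sub>0 \<alpha>) 0 (proj_class (1, m)) = 1"
proof (rule antisym[OF proj_contribution_le_1])
  have "dir_contribution (osc_set t\<^sub>0 \<alpha>) 0 (sgn (1, m)) \<le> proj_contribution (osc_set t\<^sub>0 \<alpha>) 0 (proj_class (1, m))"
    unfolding proj_contribution_def using sgn_in_eff_dirs_osc_set[OF assms] by (intro SUP_upper) simp
  then show "1 \<le> proj_contribution (osc_set t\<^sub>0 \<alpha>) 0 (proj_class (1, m))"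
    using dir_contribution_osc_set[OF assms] by simp
qed

lemma proj_class_in_proj_eff_dirs_osc_set:
  assumes "t\<^sub>0 > 0" "\<alpha> \<ge> 0" "m \<ge> 0" "m = 0 \<or> m < 1 \<and> \<alpha> \<le> 1"
  shows "proj_class (1, m) \<in> proj_eff_dirs (osc_set t\<^sub>0 \<alpha>) 0"
proof -
  have "proj_class (sgn (1, m)) \<in> proj_eff_dirs (osc_set t\<^sub>0 \<alpha>) 0"
    unfolding proj_eff_dirs_def using sgn_in_eff_dirs_osc_set[OF assms] by (rule imageI)
  then show ?thesis by (simp only: proj_class_sgn)
qed

section \<open>Point-Cross dimension of the oscillating set\<close>

lemma proj_independent_inj:
  assumes "proj_independent m \<xi>"
  shows "inj_on \<xi> {..<m}"
proof (rule inj_onI, rule ccontr)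
  fix i j assume ij: "i \<in> {..<m}" "j \<in> {..<m}" "\<xi> i = \<xi> j" "i \<noteq> j"
  obtain u where u: "\<forall>i<m. u i \<noteq> 0 \<and> \<xi> i = proj_class (u i)" "inj_on u {..<m}" "independent (u ` {..<m})"
    using assms unfolding proj_independent_def by blast
  have "u i \<in> span {u j}" using u(1) ij span_base[of "u i" "{u i}"] unfolding proj_class_def by auto
  moreover have "u j \<in> u ` {..<m} - {u i}" using u(2) ij by (auto dest: inj_onD)
  then have "span {u j} \<subseteq> span (u ` {..<m} - {u i})" by (intro span_mono) auto
  ultimately have "u i \<in> span (u ` {..<m} - {u i})" by blast
  then show False using u(3) ij unfolding dependent_def by auto
qed

lemma proj_independent_card_le:
  assumes "proj_independent m (\<xi> :: nat \<Rightarrow> 'a::euclidean_space set)"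
  shows "m \<le> DIM('a)"
proof -
  obtain u :: "nat \<Rightarrow> 'a" where "inj_on u {..<m}" "independent (u ` {..<m})"
    using assms unfolding proj_independent_def by blast
  then show ?thesis using independent_bound[of "u ` {..<m}"] by (simp add: card_image)
qed

lemma point_cross_dim_le:
  assumes "\<And>m \<xi>. m \<le> DIM('a) \<Longrightarrow> (\<And>i. i < m \<Longrightarrow> \<xi> i \<in> proj_eff_dirs A x) \<Longrightarrow> proj_independent m \<xi> \<Longrightarrow> m \<le> d"
  shows "point_cross_dim A (x :: 'a::euclidean_space) \<le> of_nat d"
  unfolding point_cross_dim_def
proof (rule SUP_least, clarify)
  fix m \<xi> assume *: "m \<le> DIM('a)" "\<forall>i<m. \<xi> i \<in> proj_eff_dirs A x" "proj_independent m \<xi>"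
  have "(\<Sum>i<m. proj_contribution A x (\<xi> i)) \<le> (\<Sum>i<m. 1)"
    by (intro sum_mono proj_contribution_le_1)
  also have "\<dots> \<le> of_nat d" using assms[of m \<xi>] * by simp
  finally show "(\<Sum>i<m. proj_contribution A x (\<xi> i)) \<le> of_nat d" .
qed

lemma sum_le_point_cross_dim:
  assumes "\<And>i. i < m \<Longrightarrow> \<xi> i \<in> proj_eff_dirs A x" "proj_independent m \<xi>"
  shows "(\<Sum>i<m. proj_contribution A x (\<xi> i)) \<le> point_cross_dim A (x :: 'a::euclidean_space)"
proof -
  have "(m, \<xi>) \<in> {(m, \<xi>). m \<le> DIM('a) \<and> (\<forall>i<m. \<xi> i \<in> proj_eff_dirs A x) \<and> proj_independent m \<xi>}"
    using assms proj_independent_card_le by auto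
  from SUP_upper[OF this, of "\<lambda>(m, \<xi>). \<Sum>i<m. proj_contribution A x (\<xi> i)"]
  show ?thesis unfolding point_cross_dim_def by simp
qed

lemma point_cross_dim_osc_set_le_1:
  assumes "t\<^sub>0 > 0" "0 \<le> \<alpha>" "\<alpha> \<le> 1"
  shows "point_cross_dim (osc_set t\<^sub>0 \<alpha>) 0 = 2"
proof (rule antisym)
  have "point_cross_dim (osc_set t\<^sub>0 \<alpha>) 0 \<le> of_nat 2"
    by (rule point_cross_dim_le) simp
  then show "point_cross_dim (osc_set t\<^sub>0 \<alpha>) 0 \<le> 2" by simp
  define s :: "nat \<Rightarrow> real" where "s i = real i / 2" for i
  have s: "s i \<ge> 0" "s i < 1" if "i < 2" for i using that unfolding s_def by auto
  have set2: "{..<2::nat} = {0, 1}" by auto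
  have "proj_independent 2 (\<lambda>i. proj_class (1 :: real, s i))"
    unfolding proj_independent_def
  proof (intro exI[of _ "\<lambda>i. (1 :: real, s i)"] conjI allI impI)
    show "inj_on (\<lambda>i. (1 :: real, s i)) {..<2}" unfolding s_def by (auto intro: inj_onI)
    show "independent ((\<lambda>i. (1 :: real, s i)) ` {..<2})"
      unfolding set2 s_def by (auto simp: independent_insert span_singleton zero_prod_def)
  qed (auto simp: zero_prod_def)
  then have "(\<Sum>i<2. proj_contribution (osc_set t\<^sub>0 \<alpha>) 0 (proj_class (1 :: real, s i))) \<le> point_cross_dim (osc_set t\<^sub>0 \<alpha>) 0"
    using assms s by (intro sum_le_point_cross_dim[where \<xi> = "\<lambda>i. proj_class (1 :: real, s i)"]
        proj_class_in_proj_eff_dirs_osc_set) auto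
  moreover have "(\<Sum>i<2. proj_contribution (osc_set t\<^sub>0 \<alpha>) 0 (proj_class (1 :: real, s i))) = (\<Sum>i<(2::nat). 1)"
    using assms s by (intro sum.cong proj_contribution_osc_set) auto
  ultimately show "2 \<le> point_cross_dim (osc_set t\<^sub>0 \<alpha>) 0" by simp
qed

text \<open>The set lies in the closed cusp bounded by the curves
  \<open>\<plusminus> x powr \<alpha>\<close>. Along a rescaled tangent sequence the second
  coordinate is at most \<open>fst (X k) powr (\<alpha> - 1)\<close> times the first, and for
  \<open>\<alpha> > 1\<close> this factor tends to 0.\<close>

lemma proj_eff_dirs_osc_set_gt_1:
  assumes "\<alpha> > 1" "\<xi> \<in> proj_eff_dirs (osc_set t\<^sub>0 \<alpha>) 0"
  shows "\<xi> = proj_class (1, 0)"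
proof -
  let ?A = "osc_set t\<^sub>0 \<alpha>"
  obtain v where v: "v \<in> eff_dirs ?A 0" "\<xi> = proj_class v" using assms(2) unfolding proj_eff_dirs_def by blast
  then have v': "v \<in> tangent_cone ?A 0" "norm v = 1" unfolding eff_dirs_def by (auto split: if_splits)
  then obtain X l where X: "\<And>k. X k \<in> ?A" "X \<longlonglongrightarrow> 0" "\<And>k. l k > (0::real)" "(\<lambda>k. (X k - 0) /\<^sub>R l k) \<longlonglongrightarrow> v"
    unfolding tangent_cone_def by blast
  have "?A \<subseteq> {p. 0 \<le> fst p \<and> \<bar>snd p\<bar> \<le> fst p powr \<alpha>}"
    unfolding osc_set_def
  proof (rule closure_minimal)
    have "continuous_on {p :: real \<times> real. 0 \<le> fst p} (\<lambda>p. fst p powr \<alpha> - \<bar>snd p\<bar>)"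
      using assms(1) by (intro continuous_intros continuous_on_powr') auto
    moreover have "closed {p :: real \<times> real. 0 \<le> fst p}"
      by (intro closed_Collect_le continuous_intros)
    ultimately have "closed ({p :: real \<times> real. 0 \<le> fst p} \<inter> (\<lambda>p. fst p powr \<alpha> - \<bar>snd p\<bar>) -` {0..})"
      by (intro continuous_closed_preimage) auto
    moreover have "{p :: real \<times> real. 0 \<le> fst p} \<inter> (\<lambda>p. fst p powr \<alpha> - \<bar>snd p\<bar>) -` {0..}
      = {p. 0 \<le> fst p \<and> \<bar>snd p\<bar> \<le> fst p powr \<alpha>}" by auto
    ultimately show "closed {p :: real \<times> real. 0 \<le> fst p \<and> \<bar>snd p\<bar> \<le> fst p powr \<alpha>}" by simp
  qed (auto simp: abs_mult intro!: mult_left_le)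
  then have A: "0 \<le> fst (X k)" "\<bar>snd (X k)\<bar> \<le> fst (X k) powr \<alpha>" for k using X(1)[of k] by auto
  have l1: "(\<lambda>k. fst (X k) / l k) \<longlonglongrightarrow> fst v" "(\<lambda>k. snd (X k) / l k) \<longlonglongrightarrow> snd v"
    using tendsto_fst[OF X(4)] tendsto_snd[OF X(4)] by (simp_all add: divide_inverse mult.commute)
  have "(\<lambda>k. fst (X k) powr (\<alpha> - 1)) \<longlonglongrightarrow> 0 powr (\<alpha> - 1)"
    using tendsto_fst[OF X(2)] assms(1) A(1) by (intro tendsto_powr') auto
  then have "(\<lambda>k. fst (X k) powr (\<alpha> - 1) * (fst (X k) / l k)) \<longlonglongrightarrow> 0 powr (\<alpha> - 1) * fst v"
    using l1(1) by (rule tendsto_mult)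
  then have bound_lim: "(\<lambda>k. fst (X k) powr (\<alpha> - 1) * (fst (X k) / l k)) \<longlonglongrightarrow> 0" by simp
  have "norm (snd (X k) / l k) \<le> fst (X k) powr (\<alpha> - 1) * (fst (X k) / l k)" for k
  proof -
    have "fst (X k) powr \<alpha> = fst (X k) powr (\<alpha> - 1) * fst (X k)"
      using A(1)[of k] by (cases "fst (X k) = 0") (auto simp: powr_diff)
    then show ?thesis using A(2)[of k] X(3)[of k] by (simp add: divide_right_mono)
  qed
  then have "eventually (\<lambda>k. norm (snd (X k) / l k) \<le> fst (X k) powr (\<alpha> - 1) * (fst (X k) / l k)) sequentially"
    by (intro always_eventually allI)
  then have "(\<lambda>k. snd (X k) / l k) \<longlonglongrightarrow> 0"
    using bound_lim by (rule Lim_null_comparison)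
  then have "snd v = 0" using l1(2) by (intro LIMSEQ_unique)
  then have "v = (fst v) *\<^sub>R (1, 0)" by (simp add: prod_eq_iff)
  moreover have "\<bar>fst v\<bar> = 1" using v'(2) \<open>snd v = 0\<close> by (simp add: norm_prod_def)
  ultimately have "proj_class v = proj_class (1, 0)"
    by (metis proj_class_scaleR abs_zero zero_neq_one)
  then show ?thesis using v by simp
qed

lemma point_cross_dim_osc_set_gt_1:
  assumes "t\<^sub>0 > 0" "\<alpha> > 1"
  shows "point_cross_dim (osc_set t\<^sub>0 \<alpha>) 0 = 1"
proof (rule antisym)
  have "point_cross_dim (osc_set t\<^sub>0 \<alpha>) 0 \<le> of_nat 1"
  proof (rule point_cross_dim_le)
    fix m :: nat and \<xi> :: "nat \<Rightarrow> (real \<times> real) set"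
    assume *: "\<And>i. i < m \<Longrightarrow> \<xi> i \<in> proj_eff_dirs (osc_set t\<^sub>0 \<alpha>) 0" "proj_independent m \<xi>"
    have "\<xi> ` {..<m} \<subseteq> {proj_class (1, 0)}"
      using *(1) proj_eff_dirs_osc_set_gt_1[OF assms(2)] by blast
    then have "card {..<m} \<le> card {proj_class (1 :: real, 0 :: real)}"
      by (intro card_inj_on_le[OF proj_independent_inj[OF *(2)]]) auto
    then show "m \<le> 1" by simp
  qed
  then show "point_cross_dim (osc_set t\<^sub>0 \<alpha>) 0 \<le> 1" by simp
  have "proj_independent 1 (\<lambda>_. proj_class (1 :: real, 0 :: real))"
    unfolding proj_independent_def
  proof (intro exI[of _ "\<lambda>_. (1 :: real, 0 :: real)"] conjI allI impI)
    show "independent ((\<lambda>_. (1 :: real, 0 :: real)) ` {..<1::nat})"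
      by (simp add: lessThan_Suc zero_prod_def)
  qed (auto simp: zero_prod_def inj_on_def)
  then have "(\<Sum>i<(1::nat). proj_contribution (osc_set t\<^sub>0 \<alpha>) 0 (proj_class (1, 0))) \<le> point_cross_dim (osc_set t\<^sub>0 \<alpha>) 0"
    using assms by (intro sum_le_point_cross_dim[where \<xi> = "\<lambda>_. proj_class (1 :: real, 0 :: real)"]
        proj_class_in_proj_eff_dirs_osc_set) auto
  then show "1 \<le> point_cross_dim (osc_set t\<^sub>0 \<alpha>) 0"
    using proj_contribution_osc_set[of t\<^sub>0 \<alpha> 0] assms by simp
qed

section \<open>Canonical probes\<close>

lemma finite_card_le_2:
  fixes S :: "'a::linorder set"
  assumes "\<And>p q r. p \<in> S \<Longrightarrow> q \<in> S \<Longrightarrow> r \<in> S \<Longrightarrow> p < q \<Longrightarrow> q < r \<Longrightarrow> False"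
  shows "finite S \<and> card S \<le> 2"
proof (rule ccontr)
  assume "\<not> ?thesis"
  then have "\<exists>T\<subseteq>S. card T = 3"
    by (metis infinite_arbitrarily_large obtain_subset_with_card_n not_less_eq_eq numeral_2_eq_2 numeral_3_eq_3)
  then obtain x y z where "{x, y, z} \<subseteq> S" "x \<noteq> y" "y \<noteq> z" "x \<noteq> z"
    unfolding card_3_iff by blast
  then show False using assms
    by (metis insert_subset linorder_neqE)
qed

text \<open>The bound is \<open>N * (n + 1)\<close> because the degenerate window
  \<open>{a..a}\<close> at \<open>n = 0\<close> is already charged \<open>N\<close>.\<close>

lemma card_window_le:
  fixes S :: "real set"
  assumes "\<And>c. c \<ge> a \<Longrightarrow> finite (S \<inter> {c..c+h}) \<and> card (S \<inter> {c..c+h}) \<le> N" "h \<ge> 0"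
  shows "finite (S \<inter> {a..a + real n * h}) \<and> card (S \<inter> {a..a + real n * h}) \<le> N * (n + 1)"
proof (induction n)
  case 0
  have "S \<inter> {a..a} \<subseteq> S \<inter> {a..a+h}" using assms(2) by auto
  then show ?case using assms(1)[of a] card_mono[of "S \<inter> {a..a+h}" "S \<inter> {a..a}"] finite_subset
    by (simp; fastforce)
next
  case (Suc n)
  let ?c = "a + real n * h"
  have "S \<inter> {a..a + real (Suc n) * h} \<subseteq> (S \<inter> {a..?c}) \<union> (S \<inter> {?c..?c+h})"
    by (auto simp: algebra_simps)
  moreover have fin: "finite (S \<inter> {?c..?c+h})" "card (S \<inter> {?c..?c+h}) \<le> N"
    using assms by auto
  moreover have fin': "finite ((S \<inter> {a..?c}) \<union> (S \<inter> {?c..?c+h}))" using Suc fin by simp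
  moreover have "card ((S \<inter> {a..?c}) \<union> (S \<inter> {?c..?c+h})) \<le> N * (n + 1) + N"
    using card_Un_le[of "S \<inter> {a..?c}" "S \<inter> {?c..?c+h}"] Suc fin by linarith
  ultimately show ?case
    using card_mono[of "(S \<inter> {a..?c}) \<union> (S \<inter> {?c..?c+h})" "S \<inter> {a..a + real (Suc n) * h}"]
      finite_subset[of "S \<inter> {a..a + real (Suc n) * h}"] by simp
qed

lemma abs_sin_diff_le: "\<bar>sin x - sin y\<bar> \<le> \<bar>x - y\<bar>" for x y :: real
proof -
  have "\<bar>sin x - sin y\<bar> = 2 * \<bar>sin ((x - y) / 2)\<bar> * \<bar>cos ((x + y) / 2)\<bar>"
    unfolding sin_diff_sin by (simp add: abs_mult)
  also have "\<dots> \<le> 2 * \<bar>(x - y) / 2\<bar> * 1"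
    by (intro mult_mono abs_sin_x_le_abs_x) auto
  finally show ?thesis by simp
qed

text \<open>With \<open>\<theta> = 1 / t\<close> the equation reads
  \<open>m * t = t powr \<alpha> * sin (1 / t)\<close>, so the line meets the graph at abscissa
  \<open>t\<close>. The lower bound on \<open>\<theta>\<close> makes
  \<open>\<bar>m\<bar> / \<theta>\<close> at most 1/20.\<close>

definition crossings :: "real \<Rightarrow> real \<Rightarrow> real set" where
  "crossings \<alpha> m = {\<theta>. \<theta> \<ge> 20 * (\<bar>m\<bar> + 1) \<and> sin \<theta> = m * \<theta> powr (\<alpha> - 1)}"

text \<open>Three nearby zeros of \<open>sin \<theta> - m * \<theta> powr (\<alpha> - 1)\<close> would yield nearby zeros of its first two
  derivatives, so that \<open>cos\<close> and \<open>sin\<close> would both be small there.\<close>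

lemma no_three_crossings:
  assumes \<alpha>: "0 \<le> \<alpha>" "\<alpha> \<le> 1"
    and "p \<in> crossings \<alpha> m" "q \<in> crossings \<alpha> m" "r \<in> crossings \<alpha> m" "p < q" "q < r"
  shows "r > p + 1/2"
proof (rule ccontr)
  assume "\<not> ?thesis"
  then have pr: "r \<le> p + 1/2" by simp
  let ?M = "20 * (\<bar>m\<bar> + 1)"
  have p: "p \<ge> ?M" using assms unfolding crossings_def by auto
  have p20: "p \<ge> 20" using p by (rule order_trans[rotated]) simp
  define g where "g \<theta> = sin \<theta> - m * \<theta> powr (\<alpha> - 1)" for \<theta>
  define g' where "g' \<theta> = cos \<theta> - m * ((\<alpha> - 1) * \<theta> powr (\<alpha> - 2))" for \<theta>
  define g'' where "g'' \<theta> = - sin \<theta> - m * ((\<alpha> - 1) * ((\<alpha> - 2) * \<theta> powr (\<alpha> - 3)))" for \<theta>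
  have g: "g p = 0" "g q = 0" "g r = 0" using assms unfolding crossings_def g_def by auto
  have D: "(g has_real_derivative g' \<theta>) (at \<theta>)" "(g' has_real_derivative g'' \<theta>) (at \<theta>)" if "\<theta> \<ge> p" for \<theta>
  proof -
    have "\<theta> > 0" using that p20 by linarith
    then show "(g has_real_derivative g' \<theta>) (at \<theta>)" "(g' has_real_derivative g'' \<theta>) (at \<theta>)"
      unfolding g_def g'_def g''_def by (auto intro!: derivative_eq_intros simp: algebra_simps)
  qed
  obtain x where x: "p < x" "x < q" "g' x = 0"
    using MVT2[OF \<open>p < q\<close>, of g g'] D(1) g by auto
  obtain y where y: "q < y" "y < r" "g' y = 0"
    using MVT2[OF \<open>q < r\<close>, of g g'] D(1) g \<open>p < q\<close> by fastforce
  obtain z where z: "x < z" "z < y" "g'' z = 0"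
    using MVT2[of x y g' g''] D(2) x y by fastforce
  \<comment> \<open>As \<open>\<alpha> \<le> 1\<close>, the exponents \<open>\<alpha> - 2\<close>
    and \<open>\<alpha> - 3\<close> in the derivatives are at most -1, so the threshold on
    \<open>\<theta>\<close> absorbs a slope of any size.\<close>
  have small: "\<bar>m\<bar> * \<theta> powr e \<le> 1/20" if "\<theta> \<ge> p" "e \<le> -1" for \<theta> e
  proof -
    have t: "\<theta> \<ge> ?M" "\<theta> \<ge> 1" using that p p20 by (blast intro: order_trans, linarith)
    have "\<theta> powr e \<le> \<theta> powr (-1)" using t that by (intro powr_mono) auto
    also have "\<dots> = 1 / \<theta>" using t by (simp add: powr_minus divide_inverse)
    also have "\<dots> \<le> 1 / ?M" using t by (intro frac_le) auto
    finally have "\<bar>m\<bar> * \<theta> powr e \<le> \<bar>m\<bar> * (1 / ?M)" by (intro mult_left_mono) auto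
    also have "\<dots> \<le> 1 / 20" by (simp add: field_simps)
    finally show ?thesis .
  qed
  have "cos x = m * ((\<alpha> - 1) * x powr (\<alpha> - 2))" using x(3) unfolding g'_def by simp
  then have "\<bar>cos x\<bar> = \<bar>\<alpha> - 1\<bar> * (\<bar>m\<bar> * x powr (\<alpha> - 2))" by (simp add: abs_mult mult_ac)
  also have "\<dots> \<le> 1 * (1 / 20)" using \<alpha> x by (intro mult_mono small) auto
  finally have c: "\<bar>cos x\<bar> \<le> 1 / 20" by simp
  have "sin z = - (m * ((\<alpha> - 1) * ((\<alpha> - 2) * z powr (\<alpha> - 3))))" using z(3) unfolding g''_def by simp
  then have "\<bar>sin z\<bar> = (\<bar>\<alpha> - 1\<bar> * \<bar>\<alpha> - 2\<bar>) * (\<bar>m\<bar> * z powr (\<alpha> - 3))" by (simp add: abs_mult mult_ac)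
  also have "\<dots> \<le> (1 * 2) * (1 / 20)" using \<alpha> x z by (intro mult_mono small) auto
  \<comment> \<open>Moving from \<open>z\<close> to \<open>x\<close> costs at most 1/2, since both
    lie between \<open>p\<close> and \<open>r\<close>; thus 1/10 becomes 3/5, and
    \<open>(3/5)\<^sup>2 + (1/20)\<^sup>2 < 1\<close>.\<close>
  finally have "\<bar>sin x\<bar> \<le> 3 / 5"
    using abs_sin_diff_le[of x z] x y z pr by linarith
  then have "\<bar>sin x\<bar>\<^sup>2 \<le> (3/5)\<^sup>2" by (intro power_mono) auto
  moreover have "\<bar>cos x\<bar>\<^sup>2 \<le> (1/20)\<^sup>2" using c by (intro power_mono) auto
  ultimately show False using sin_cos_squared_add[of x] by (simp add: power2_eq_square)
qed

text \<open>A window of length 1/2 contains at most two crossings, and about \<open>2 * R\<close>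
  windows reach from the threshold beyond \<open>R\<close>.\<close>

lemma card_crossings_le:
  assumes "0 \<le> \<alpha>" "\<alpha> \<le> 1" "R \<ge> 0"
  shows "finite (crossings \<alpha> m \<inter> {..R}) \<and> real (card (crossings \<alpha> m \<inter> {..R})) \<le> 4 * R + 4"
proof -
  let ?a = "20 * (\<bar>m\<bar> + 1)"
  define n where "n = nat \<lceil>2 * R\<rceil>"
  have n: "2 * R \<le> real n" "real n \<le> 2 * R + 1" using assms(3) unfolding n_def by linarith+
  have "finite (crossings \<alpha> m \<inter> {c..c + 1/2}) \<and> card (crossings \<alpha> m \<inter> {c..c + 1/2}) \<le> 2" for c
  proof (rule finite_card_le_2)
    fix p q r assume "p \<in> crossings \<alpha> m \<inter> {c..c + 1/2}" "q \<in> crossings \<alpha> m \<inter> {c..c + 1/2}"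
      "r \<in> crossings \<alpha> m \<inter> {c..c + 1/2}" "p < q" "q < r"
    then show False using no_three_crossings[OF assms(1,2), of p m q r] by auto
  qed
  from card_window_le[of ?a "crossings \<alpha> m" "1/2" 2 n, OF this]
  have fin: "finite (crossings \<alpha> m \<inter> {?a..?a + real n * (1/2)})"
    and card: "card (crossings \<alpha> m \<inter> {?a..?a + real n * (1/2)}) \<le> 2 * (n + 1)" by auto
  have sub: "crossings \<alpha> m \<inter> {..R} \<subseteq> crossings \<alpha> m \<inter> {?a..?a + real n * (1/2)}"
    using n(1) unfolding crossings_def by auto
  have "card (crossings \<alpha> m \<inter> {..R}) \<le> 2 * (n + 1)" using card_mono[OF fin sub] card by simp
  then have "real (card (crossings \<alpha> m \<inter> {..R})) \<le> real (2 * (n + 1))" by (simp only: of_nat_le_iff)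
  then show ?thesis using n(2) finite_subset[OF sub fin] by simp
qed

text \<open>At scale \<open>\<epsilon>\<close>, the part with \<open>t \<le> sqrt \<epsilon>\<close>
  is covered as a segment by order \<open>1 / sqrt \<epsilon>\<close> sets. The rest consists of
  crossings with \<open>1 / t\<close> below \<open>1 / sqrt \<epsilon>\<close>, whose number is at
  most of the same order. This balance gives the exponent 1/2.\<close>

lemma straight_probe_contribution_le:
  assumes \<alpha>: "0 \<le> \<alpha>" "\<alpha> \<le> 1" and p: "p \<in> straight_probes M"
  shows "probe_contribution (osc_set t\<^sub>0 \<alpha>) 0 p \<le> ennreal (1/2)"
proof -
  obtain \<delta> m where pm: "p = (\<delta>, \<lambda>t. t *\<^sub>R (1, m))" "\<delta> > 0" using p unfolding straight_probes_def by blast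
  define line where "line = (\<lambda>t::real. t *\<^sub>R (1 :: real, m))"
  \<comment> \<open>The reciprocal of the threshold in \<open>crossings\<close>: inside this ball
    \<open>1 / t\<close> is beyond it, because
    \<open>\<bar>t\<bar> \<le> norm (line t)\<close>.\<close>
  define r where "r = 1 / (20 * (\<bar>m\<bar> + 1))"
  have r: "r > 0" unfolding r_def by (simp add: add_nonneg_pos)
  define E where "E = osc_set t\<^sub>0 \<alpha> \<inter> line ` {0..\<delta>} \<inter> ball 0 r"
  define N where "N = norm (1 :: real, m)"
  have N: "N \<ge> 1" using norm_fst_le[of "1::real" m] unfolding N_def by simp
  have lip: "N-lipschitz_on S line" for S
    unfolding line_def N_def
    by (intro lipschitz_onI) (auto simp: dist_norm norm_Pair simp flip: scaleR_diff_left diff_Pair scaleR_Pair left_diff_distrib)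
  have cover: "E \<subseteq> line ` {0..\<tau>} \<union> (\<lambda>\<theta>. line (1 / \<theta>)) ` (crossings \<alpha> m \<inter> {..1 / \<tau>})" if "\<tau> > 0" for \<tau>
  proof
    fix z assume z: "z \<in> E"
    then obtain t where t: "t \<ge> 0" "z = line t" unfolding E_def by auto
    show "z \<in> line ` {0..\<tau>} \<union> (\<lambda>\<theta>. line (1 / \<theta>)) ` (crossings \<alpha> m \<inter> {..1 / \<tau>})"
    proof (cases "t \<le> \<tau>")
      case False
      then have "t > 0" using \<open>\<tau> > 0\<close> by simp
      have "\<bar>t\<bar> * 1 \<le> norm z" unfolding t(2) line_def norm_scaleR using N unfolding N_def by (intro mult_left_mono) auto
      then have "t < r" using z t(1) unfolding E_def by simp
      then have "1 / r \<le> 1 / t" using \<open>t > 0\<close> by (intro frac_le) auto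
      then have "20 * (\<bar>m\<bar> + 1) \<le> 1 / t" unfolding r_def by simp
      moreover have "1 / t \<le> 1 / \<tau>" using False \<open>\<tau> > 0\<close> by (intro frac_le) auto
      moreover have "sin (1 / t) = m * (1 / t) powr (\<alpha> - 1)"
      proof -
        have "(t, t * m) \<in> osc_set t\<^sub>0 \<alpha>" using z t unfolding E_def line_def by simp
        then have "t * m = t powr \<alpha> * sin (1 / t)"
          using osc_set_eq_graph \<open>t > 0\<close> unfolding osc_def by blast
        then have "sin (1 / t) = m * (t / t powr \<alpha>)" using \<open>t > 0\<close> by (simp add: field_simps)
        also have "t / t powr \<alpha> = (1 / t) powr (\<alpha> - 1)"
          using \<open>t > 0\<close> by (simp add: powr_divide powr_diff)
        finally show ?thesis .
      qed
      ultimately have "1 / t \<in> crossings \<alpha> m \<inter> {..1 / \<tau>}" unfolding crossings_def by simp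
      moreover have "z = line (1 / (1 / t))" using t(2) by simp
      ultimately show ?thesis by blast
    qed (use t in auto)
  qed
  have "eventually (\<lambda>\<epsilon>. real (covering_number \<epsilon> E) \<le> (N + 10) * \<epsilon> powr (- (1/2))) (at_right 0)"
    using eventually_at_right_0_less_1
  proof eventually_elim
    case (elim \<epsilon>)
    \<comment> \<open>cover the points below \<open>\<tau>\<close> as a segment and the others one by one\<close>
    define \<tau> where "\<tau> = sqrt \<epsilon>"
    have \<tau>: "0 < \<tau>" "\<tau> < 1" "\<epsilon> = \<tau> * \<tau>" using elim unfolding \<tau>_def by auto
    have "1 / \<tau> = \<epsilon> powr (- (1/2))"
      using elim unfolding \<tau>_def powr_minus_divide by (simp add: powr_half_sqrt)
    then have final: "(N + 10) / \<tau> = (N + 10) * \<epsilon> powr (- (1/2))" by (metis divide_inverse inverse_eq_divide)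
    let ?F = "(\<lambda>\<theta>. line (1 / \<theta>)) ` (crossings \<alpha> m \<inter> {..1 / \<tau>})"
    have cr: "finite (crossings \<alpha> m \<inter> {..1 / \<tau>})" "real (card (crossings \<alpha> m \<inter> {..1 / \<tau>})) \<le> 4 * (1 / \<tau>) + 4"
      using card_crossings_le[OF \<alpha>, of "1 / \<tau>" m] \<tau> by auto
    have bdd: "bounded (line ` {0..\<tau>})"
      using lip by (intro compact_imp_bounded compact_continuous_image lipschitz_on_continuous_on) auto
    have "covering_number \<epsilon> E \<le> covering_number \<epsilon> (line ` {0..\<tau>} \<union> ?F)"
      using cover[OF \<tau>(1)] bdd cr elim by (intro covering_number_mono) (auto intro: finite_imp_bounded)
    also have "\<dots> \<le> covering_number \<epsilon> (line ` {0..\<tau>}) + covering_number \<epsilon> ?F"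
      using bdd cr elim by (intro covering_number_Un_le) (auto intro: finite_imp_bounded)
    also have "covering_number \<epsilon> ?F \<le> card ?F" using cr elim by (intro covering_number_finite_le) auto
    also have "card ?F \<le> card (crossings \<alpha> m \<inter> {..1 / \<tau>})" using cr by (intro card_image_le)
    finally have "real (covering_number \<epsilon> E) \<le> real (covering_number \<epsilon> (line ` {0..\<tau>})) + real (card (crossings \<alpha> m \<inter> {..1 / \<tau>}))"
      by linarith
    also have "real (covering_number \<epsilon> (line ` {0..\<tau>})) \<le> N * \<tau> / \<epsilon> + 2"
      using \<tau> elim by (intro covering_number_lipschitz_curve_le lip) auto
    also have "N * \<tau> / \<epsilon> = N / \<tau>" using \<tau> by (simp add: field_simps)
    also have "N / \<tau> + 2 + real (card (crossings \<alpha> m \<inter> {..1 / \<tau>})) \<le> N / \<tau> + 4 / \<tau> + 6" using cr by simp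
    also have "\<dots> \<le> N / \<tau> + 4 / \<tau> + 6 / \<tau>" using \<tau> by (simp add: field_simps)
    also have "\<dots> = (N + 10) / \<tau>" by (simp add: add_divide_distrib)
    also note final
    finally show ?case by simp
  qed
  then have "upper_box_dim E \<le> ennreal (1/2)" using N by (intro upper_box_dim_le[where C = "N + 10"]) auto
  then have "pbox_dim (osc_set t\<^sub>0 \<alpha> \<inter> line ` {0..\<delta>}) 0 \<le> ennreal (1/2)"
    unfolding E_def using r by (intro pbox_dim_le[of r])
  then show ?thesis unfolding pm probe_contribution_def line_def by simp
qed

section \<open>Arclength parametrization and vertical probes\<close>

lemma arclength_probe_lipschitz:
  assumes "(\<delta>, \<gamma>) \<in> arclength_probes x \<Gamma>"
  shows "1-lipschitz_on {0..\<delta>} \<gamma>"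
proof -
  have len: "curve_length \<gamma> 0 s = ennreal s" if "s \<in> {0..\<delta>}" for s
    using assms that unfolding arclength_probes_def by auto
  \<comment> \<open>A polygon inscribed in \<open>\<gamma>\<close> over \<open>{0..s}\<close>,
    extended by the chord from \<open>\<gamma> s\<close> to \<open>\<gamma> s'\<close>, competes for
    the length over \<open>{0..s'}\<close>; hence the chord is at most the difference of the two
    lengths, \<open>s' - s\<close>.\<close>
  have step: "dist (\<gamma> s) (\<gamma> s') \<le> s' - s" if s: "0 \<le> s" "s \<le> s'" "s' \<le> \<delta>" for s s'
  proof -
    let ?d = "dist (\<gamma> s) (\<gamma> s')"
    have add: "(\<Sum>i<k. ennreal (dist (\<gamma> (p i)) (\<gamma> (p (Suc i))))) + ennreal ?d \<le> ennreal s'"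
      if p: "mono_on {..k} p" "p ` {..k} \<subseteq> {0..s}" for k p
    proof -
      \<comment> \<open>Append the nodes \<open>s\<close> and \<open>s'\<close>; the connecting
        chord from \<open>\<gamma> (p k)\<close> to \<open>\<gamma> s\<close> is discarded at the
        end.\<close>
      define q where "q i = (if i \<le> k then p i else if i = Suc k then s else s')" for i
      have ps: "p i \<in> {0..s}" if "i \<le> k" for i using p(2) that by blast
      have "mono_on {..Suc (Suc k)} q"
      proof (rule mono_onI)
        fix i j assume "i \<in> {..Suc (Suc k)}" "j \<in> {..Suc (Suc k)}" "i \<le> j"
        moreover have "p l \<le> s" "p l \<le> s'" if "l \<le> k" for l using ps[OF that] s by auto
        ultimately show "q i \<le> q j" using s mono_onD[OF p(1), of i j] unfolding q_def by auto
      qed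
      moreover have "q ` {..Suc (Suc k)} \<subseteq> {0..s'}"
        using ps s unfolding q_def by fastforce
      ultimately have "(Suc (Suc k), q) \<in> {(k, p). mono_on {..k} p \<and> p ` {..k} \<subseteq> {0..s'}}" by blast
      from SUP_upper[OF this, of "\<lambda>(k, p). \<Sum>i<k. ennreal (dist (\<gamma> (p i)) (\<gamma> (p (Suc i))))"]
      have "(\<Sum>i<Suc (Suc k). ennreal (dist (\<gamma> (q i)) (\<gamma> (q (Suc i))))) \<le> curve_length \<gamma> 0 s'"
        unfolding curve_length_def prod.case .
      moreover have "(\<Sum>i<k. ennreal (dist (\<gamma> (q i)) (\<gamma> (q (Suc i))))) = (\<Sum>i<k. ennreal (dist (\<gamma> (p i)) (\<gamma> (p (Suc i)))))"
        unfolding q_def by (intro sum.cong) auto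
      moreover have "q (Suc k) = s" "q (Suc (Suc k)) = s'" unfolding q_def by auto
      ultimately have "(\<Sum>i<k. ennreal (dist (\<gamma> (p i)) (\<gamma> (p (Suc i))))) + ennreal (dist (\<gamma> (q k)) (\<gamma> s)) + ennreal ?d \<le> ennreal s'"
        using len[of s'] s by simp
      then show ?thesis by (rule order_trans[rotated]) (intro add_right_mono, simp)
    qed
    then have "(\<Sum>i<k. ennreal (dist (\<gamma> (p i)) (\<gamma> (p (Suc i))))) \<le> ennreal s' - ennreal ?d"
      if "mono_on {..k} p" "p ` {..k} \<subseteq> {0..s}" for k p
      using that by (simp add: ennreal_le_minus_iff)
    then have "curve_length \<gamma> 0 s \<le> ennreal s' - ennreal ?d"
      unfolding curve_length_def by (intro SUP_least) auto
    then have "ennreal s \<le> ennreal (s' - ?d)" using len[of s] s by (simp add: ennreal_minus)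
    \<comment> \<open>The partition with the single node \<open>s\<close> has no chords. The
      resulting \<open>?d \<le> s'\<close> excludes that \<open>ennreal\<close> truncates a negative
      \<open>s' - ?d\<close>.\<close>
    moreover have "ennreal ?d \<le> ennreal s'"
      using add[of 0 "\<lambda>_. s"] s by (auto simp: mono_on_def)
    then have "?d \<le> s'" using s by (subst (asm) ennreal_le_iff) linarith+
    ultimately have "s \<le> s' - ?d" by (subst (asm) ennreal_le_iff) linarith+
    then show ?thesis by linarith
  qed
  show ?thesis
  proof (rule lipschitz_onI)
    fix s s' assume "s \<in> {0..\<delta>}" "s' \<in> {0..\<delta>}"
    then show "dist (\<gamma> s) (\<gamma> s') \<le> 1 * dist s s'"
    proof (induction s s' rule: linorder_wlog)
      case (le s s')
      then have "dist (\<gamma> s) (\<gamma> s') \<le> s' - s" by (intro step) auto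
      then show ?case using le(1) by (simp add: dist_real_def)
    next
      case (sym s s')
      then show ?case unfolding dist_commute[of s] dist_commute[of "\<gamma> s"] by blast
    qed
  qed simp
qed

text \<open>Nonvanishing near 0 makes the quotients unit vectors, so \<open>v\<close> has norm 1
  instead of being 0 by the convention for division by zero; its first coordinate vanishes in the
  limit.\<close>

lemma proj_class_vertical:
  assumes "limit_direction \<gamma> 0 v"
    and "eventually (\<lambda>t. \<gamma> t \<noteq> 0) (at_right 0)"
    and "((\<lambda>t. fst (\<gamma> t) / norm (\<gamma> t)) \<longlongrightarrow> 0) (at_right 0)"
  shows "proj_class v = proj_class (0 :: real, 1 :: real)"
proof -
  have lim: "((\<lambda>t. \<gamma> t /\<^sub>R norm (\<gamma> t)) \<longlongrightarrow> v) (at_right 0)"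
    using assms(1) unfolding limit_direction_def by simp
  have "((\<lambda>t. norm (\<gamma> t /\<^sub>R norm (\<gamma> t))) \<longlongrightarrow> norm v) (at_right 0)" using lim by (rule tendsto_norm)
  moreover have "eventually (\<lambda>t. norm (\<gamma> t /\<^sub>R norm (\<gamma> t)) = 1) (at_right 0)"
    using assms(2) by eventually_elim simp
  ultimately have "((\<lambda>t. 1) \<longlongrightarrow> norm v) (at_right (0::real))" by (rule Lim_transform_eventually)
  then have "norm v = 1" by (simp add: tendsto_const_iff)
  have "((\<lambda>t. fst (\<gamma> t) / norm (\<gamma> t)) \<longlongrightarrow> fst v) (at_right 0)"
    using tendsto_fst[OF lim] by (simp add: divide_inverse mult.commute)
  then have "fst v = 0" using assms(3) tendsto_unique[OF trivial_limit_at_right_real] by blast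
  then have "v = snd v *\<^sub>R (0, 1)" by (simp add: prod_eq_iff)
  moreover have "snd v \<noteq> 0" using \<open>norm v = 1\<close> \<open>fst v = 0\<close> by (auto simp: norm_prod_def)
  ultimately show ?thesis by (metis proj_class_scaleR)
qed

text \<open>The parameter is the arclength \<open>s\<close>, not the abscissa \<open>t\<close>. The
  Lipschitz bound yields \<open>t \<le> norm (\<gamma> s) \<le> s\<close>, so the first coordinate
  of the direction is at most \<open>t powr (1 - \<alpha>) \<le> s powr (1 - \<alpha>)\<close>,
  which tends to 0.\<close>

lemma envelope_probe_vertical:
  assumes "0 < \<alpha>" "\<alpha> < 1" "(\<delta>, \<gamma>) \<in> arclength_probes 0 ((\<lambda>t. (t, t powr \<alpha>)) ` {0..t\<^sub>0})"
    and "limit_direction \<gamma> 0 v"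
  shows "proj_class v = proj_class (0 :: real, 1 :: real)"
proof (rule proj_class_vertical[OF assms(4)])
  have \<gamma>: "\<delta> > 0" "\<gamma> 0 = 0" "inj_on \<gamma> {0..\<delta>}" "\<gamma> ` {0..\<delta>} = (\<lambda>t. (t, t powr \<alpha>)) ` {0..t\<^sub>0}"
    using assms(3) unfolding arclength_probes_def by auto
  have ev: "eventually (\<lambda>s. 0 < s \<and> s < \<delta>) (at_right 0)"
    using \<gamma>(1) by (intro eventually_at_rightI[of 0 \<delta>]) auto
  have nz: "\<gamma> s \<noteq> 0" if "0 < s" "s < \<delta>" for s
    using inj_onD[OF \<gamma>(3), of s 0] \<gamma>(2) that by auto
  show "eventually (\<lambda>s. \<gamma> s \<noteq> 0) (at_right 0)" using ev by eventually_elim (use nz in auto)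
  show "((\<lambda>s. fst (\<gamma> s) / norm (\<gamma> s)) \<longlongrightarrow> 0) (at_right 0)"
  proof (rule Lim_null_comparison)
    show "eventually (\<lambda>s. norm (fst (\<gamma> s) / norm (\<gamma> s)) \<le> s powr (1 - \<alpha>)) (at_right 0)"
      using ev
    proof eventually_elim
      case (elim s)
      then have "\<gamma> s \<in> \<gamma> ` {0..\<delta>}" by simp
      then have "\<gamma> s \<in> (\<lambda>t. (t, t powr \<alpha>)) ` {0..t\<^sub>0}" unfolding \<gamma>(4) .
      then obtain t where t: "t \<ge> 0" "\<gamma> s = (t, t powr \<alpha>)" by auto
      then have "t > 0" using nz[of s] elim by (cases "t = 0") (auto simp: zero_prod_def)
      have "norm (\<gamma> s) \<le> s"
        using lipschitz_onD[OF arclength_probe_lipschitz[OF assms(3)], of s 0] elim \<gamma>(2) by simp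
      moreover have "t \<le> norm (\<gamma> s)" using norm_fst_le[of t "t powr \<alpha>"] t by simp
      ultimately have "t \<le> s" by simp
      have "t powr \<alpha> \<le> norm (\<gamma> s)" using norm_snd_le[of "t powr \<alpha>" t] t by simp
      then have "t / norm (\<gamma> s) \<le> t / t powr \<alpha>" using \<open>t > 0\<close> by (intro frac_le) auto
      also have "\<dots> = t powr (1 - \<alpha>)" using \<open>t > 0\<close> by (simp add: powr_diff)
      also have "\<dots> \<le> s powr (1 - \<alpha>)" using t \<open>t \<le> s\<close> assms by (intro powr_mono2) auto
      finally show ?case using t by simp
    qed
    show "((\<lambda>s. s powr (1 - \<alpha>)) \<longlongrightarrow> 0) (at_right 0)" using assms(2) by real_asymp
  qed
qed

section \<open>Upper bound for the canonical profile\<close>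

lemma canonical_probe_cases:
  assumes \<alpha>: "0 \<le> \<alpha>" "\<alpha> \<le> 1" and p: "p \<in> canonical_probes t\<^sub>0 \<alpha>" "limit_direction (snd p) 0 v"
  shows "probe_contribution (osc_set t\<^sub>0 \<alpha>) 0 p \<le> ennreal (1/2) \<or>
    probe_contribution (osc_set t\<^sub>0 \<alpha>) 0 p \<le> 1 \<and> proj_class v = proj_class (0, 1)"
proof -
  obtain \<delta> \<gamma> where p\<gamma>: "p = (\<delta>, \<gamma>)" by fastforce
  have le_1: "probe_contribution (osc_set t\<^sub>0 \<alpha>) 0 (\<delta>, \<gamma>) \<le> 1" if "L-lipschitz_on {0..\<delta>} \<gamma>" "\<delta> > 0" for L
    unfolding probe_contribution_def using that(2)
    by (auto intro!: pbox_dim_le[of 1] upper_box_dim_lipschitz_curve_le_1[OF that(1)])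
  \<comment> \<open>The sign \<open>c\<close> covers both halves of the vertical segment;
    \<open>\<alpha> = 1\<close> falls under the straight probes.\<close>
  consider M where "p \<in> straight_probes M"
    | c where "\<alpha> = 0" "p = (1, \<lambda>t. (0, c * t))" "\<bar>c\<bar> = 1"
    | "0 < \<alpha>" "\<alpha> < 1" "p \<in> arclength_probes 0 ((\<lambda>t. (t, t powr \<alpha>)) ` {0..t\<^sub>0})"
  proof (cases "p \<in> straight_probes UNIV \<or> p \<in> straight_probes {-1..1}")
    case False
    then consider "\<alpha> = 0" "p = (1, \<lambda>t. (0, t))" | "\<alpha> = 0" "p = (1, \<lambda>t. (0, - t))"
      | "0 < \<alpha>" "\<alpha> < 1" "p \<in> arclength_probes 0 ((\<lambda>t. (t, t powr \<alpha>)) ` {0..t\<^sub>0})"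
      using p(1) \<alpha> unfolding canonical_probes_def by (auto split: if_splits)
    then show ?thesis using that(2)[of 1] that(2)[of "-1"] that(3) by cases auto
  qed (use that(1) in blast)
  then show ?thesis
  proof cases
    case 1
    then show ?thesis using straight_probe_contribution_le[OF \<alpha>] by blast
  next
    case 2
    then have \<gamma>: "\<delta> = 1" "\<gamma> = (\<lambda>t. (0, c * t))" using p\<gamma> by auto
    have "1-lipschitz_on {0..\<delta>} \<gamma>" unfolding \<gamma>
      using 2(3) by (intro lipschitz_onI) (auto simp: dist_Pair_Pair dist_real_def abs_mult simp flip: right_diff_distrib)
    moreover have "proj_class v = proj_class (0, 1)"
    proof (rule proj_class_vertical)
      show "eventually (\<lambda>t. \<gamma> t \<noteq> 0) (at_right 0)"
        using eventually_at_right_0_less_1 by eventually_elim (use 2(3) in \<open>auto simp: \<gamma> zero_prod_def\<close>)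
    qed (use p p\<gamma> \<gamma> in auto)
    moreover have "\<delta> > 0" using \<gamma> by simp
    ultimately show ?thesis using le_1 p\<gamma> by blast
  next
    case 3
    then have "1-lipschitz_on {0..\<delta>} \<gamma>" "\<delta> > 0"
      using arclength_probe_lipschitz[of \<delta> \<gamma>] unfolding p\<gamma> arclength_probes_def by auto
    moreover have "proj_class v = proj_class (0, 1)"
      using envelope_probe_vertical[of \<alpha> \<delta> \<gamma>] 3 p(2) unfolding p\<gamma> by simp
    ultimately show ?thesis using le_1 p\<gamma> by blast
  qed
qed

text \<open>At most two directions are independent, and they are distinct, so at most one is
  vertical; any other contributes at most 1/2, which caps the sum at \<open>1 + 1/2\<close>.\<close>

lemma canonical_profile_le:
  assumes \<alpha>: "0 \<le> \<alpha>" "\<alpha> \<le> 1"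
  shows "canonical_profile t\<^sub>0 \<alpha> \<le> ennreal (3/2)"
  unfolding canonical_profile_def
proof (rule SUP_least, clarify)
  fix m :: nat and P :: "nat \<Rightarrow> real \<times> (real \<Rightarrow> real \<times> real)" and v :: "nat \<Rightarrow> real \<times> real"
  assume P: "\<forall>i<m. P i \<in> canonical_probes t\<^sub>0 \<alpha>" "\<forall>i<m. limit_direction (snd (P i)) 0 (v i)"
    and ind: "proj_independent m (\<lambda>i. proj_class (v i))"
  define c where "c i = probe_contribution (osc_set t\<^sub>0 \<alpha>) 0 (P i)" for i
  have cases: "c i \<le> ennreal (1/2) \<or> c i \<le> 1 \<and> proj_class (v i) = proj_class (0, 1)" if "i < m" for i
    using canonical_probe_cases[OF \<alpha>] P that unfolding c_def by blast
  have half: "ennreal (1/2) \<le> 1" by (subst ennreal_1[symmetric], rule ennreal_leI) simp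
  then have le_1: "c i \<le> 1" if "i < m" for i using cases[OF that] by auto
  have sum1: "1 + ennreal (1/2) = ennreal (3/2)"
    by (subst ennreal_1[symmetric], subst ennreal_plus[symmetric]) auto
  have "m \<le> 2" using proj_independent_card_le[OF ind] by simp
  then consider "m = 0" | "m = 1" | "m = 2" by linarith
  then have "(\<Sum>i<m. c i) \<le> ennreal (3/2)"
  proof cases
    case 2
    have "c 0 \<le> 1" using le_1 2 by simp
    also have "1 \<le> ennreal (3/2)" by (subst ennreal_1[symmetric], rule ennreal_leI) simp
    finally show ?thesis using 2 by simp
  next
    case 3
    have "proj_class (v 0) \<noteq> proj_class (v 1)"
      using proj_independent_inj[OF ind] 3 by (auto dest: inj_onD)
    then have "c 0 \<le> ennreal (1/2) \<or> c 1 \<le> ennreal (1/2)" using cases[of 0] cases[of 1] 3 by auto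
    then have "c 0 + c 1 \<le> 1 + ennreal (1/2)"
    proof
      assume "c 0 \<le> ennreal (1/2)"
      then show ?thesis using le_1[of 1] 3 add_mono[of "c 1" 1 "c 0" "ennreal (1/2)"] by (simp add: add.commute)
    next
      assume "c 1 \<le> ennreal (1/2)"
      then show ?thesis using le_1[of 0] 3 by (intro add_mono) auto
    qed
    moreover have "{..<2::nat} = {0, 1}" by auto
    ultimately show ?thesis unfolding 3 using sum1 by simp
  qed simp
  then show "(\<Sum>i<m. probe_contribution (osc_set t\<^sub>0 \<alpha>) 0 (P i)) \<le> ennreal (3/2)" unfolding c_def .
qed

theorem proposition4p39:
  fixes t\<^sub>0 \<alpha> :: real
  assumes "t\<^sub>0 > 0" and "\<alpha> \<ge> 0"
  shows "point_cross_dim (osc_set t\<^sub>0 \<alpha>) 0 = (if \<alpha> \<le> 1 then 2 else 1) \<and>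
         (\<alpha> \<le> 1 \<longrightarrow> canonical_profile t\<^sub>0 \<alpha> < point_cross_dim (osc_set t\<^sub>0 \<alpha>) 0)"
proof (cases "\<alpha> \<le> 1")
  case True
  have "canonical_profile t\<^sub>0 \<alpha> \<le> ennreal (3/2)" using canonical_profile_le assms True by blast
  also have "\<dots> < 2" by (subst ennreal_numeral[symmetric], subst ennreal_less_iff) auto
  finally show ?thesis using point_cross_dim_osc_set_le_1 assms True by simp
next
  case False
  then show ?thesis using point_cross_dim_osc_set_gt_1 assms by simp
qed

end
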